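(* Let $(\mathbb{X},\mathcal{X})$ be a Borel space with a $\sigma$-finite diffuse measure $\lambda$. Let $\kappa\colon\mathbb{X}\times\mathbf{N}\to[0,\infty)$ be measurable with $\kappa(x,\mu)\kappa(y,\mu+\delta_x)=\kappa(y,\mu)\kappa(x,\mu+\delta_y)$ for all $(x,y,\mu)\in\mathbb{X}^2\times\mathbf{N}$, and let $\sim$ be a symmetric relation on $\mathbb{X}$ such that $\{(x,y):x\sim y\}$ is measurable in $\mathbb{X}^2$. Assume: (a) there is a measurable $\alpha\colon\mathbb{X}\to(0,\infty)$ with $\kappa(x,\mu)\le\alpha(x)$ for all $(x,\mu)\in\mathbb{X}\times\mathbf{N}$ and $\int_B\alpha\,\mathrm{d}\lambda<\infty$ for all $B\in\mathcal{X}$ with $\lambda(B)<\infty$; (b) $\kappa(x,\mu)=\kappa(x,C(x,\mu))$ for all $(x,\mu)\in\mathbb{X}\times\mathbf{N}$, where $C(x,\mu)$ is the cluster of $x$ in $\mu$. Let $\xi$ be a Gibbs process on $\mathbb{X}$ with Papangelou intensity $\kappa$ and let $B\in\mathcal{X}$ with $\lambda(B)<\infty$. Then, $\mathbb{P}$-a.s., $$\mathbb{P}(\xi(B)=0\mid\xi_{B^c})\le\exp\bigg[-\int\mathbf{1}\{x\in B_\xi\}\,e^{-(\alpha\lambda)(N_x\cap B)}\,\kappa(x,0)\,\lambda(\mathrm{d}x)\bigg],$$ where $N_x:=\{y\in\mathbb{X}\setminus\{x\}:y\sim x\}$, $B_\xi:=\{x\in B:x\not\sim\xi_{B^c}\}=B\setminus\bigcup_{y\in\xi_{B^c}}N_y$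 and $(\alpha\lambda)(A):=\int_A\alpha\,\mathrm{d}\lambda$.
   Context: $\mathbf{N}$ is the set of all measures on $\mathbb{X}$ which are $\mathbb{N}_0$-valued on all $B\in\mathcal{X}$ with $\lambda(B)<\infty$, with the $\sigma$-field generated by $\mu\mapsto\mu(B)$, $B\in\mathcal{X}$; a point process is a random element of $\mathbf{N}$. $\mu_B:=\mu(B\cap\cdot)$; $x\in\mu$ means $\mu(\{x\})>0$; $0$ also denotes the zero measure. A measure is diffuse if it has no atoms at points. A point process $\xi$ is a Gibbs process with Papangelou intensity $\kappa$ if $\mathbb{E}\int f(x,\xi)\,\xi(\mathrm{d}x)=\mathbb{E}\int f(x,\xi+\delta_x)\kappa(x,\xi)\,\lambda(\mathrm{d}x)$ for all measurable $f\colon\mathbb{X}\times\mathbf{N}\to[0,\infty)$. For a counting measure $\mu$, $x\sim\mu$ means $x\sim z$ for some $z\in\mu$. Points $x,z$ are connected via $\mu$ if there are $n\in\mathbb{N}_0$ and $z_1,\ldots,z_n\in\mu$ with $z_i\sim z_{i+1}$ for $i=0,\ldots,n$, where $z_0:=x$, $z_{n+1}:=z$. $C(x,\mu):=\int\mathbf{1}\{y\in\cdot\}\mathbf{1}\{y\ne x\text{ and }x,y\text{ are connected via }\mu\}\,\mu(\mathrm{d}y)$. *)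

theory Defs
  imports "HOL-Probability.Probability"
begin

(* Borel isomorphic to a Borel subset of the unit interval. *)
definition is_borel_space :: "'a measure \<Rightarrow> bool" where
  "is_borel_space L \<longleftrightarrow>
     (\<exists>U f g. U \<in> sets (borel :: real measure) \<and> U \<subseteq> {0..1} \<and>
        f \<in> L \<rightarrow>\<^sub>M restrict_space borel U \<and> g \<in> restrict_space borel U \<rightarrow>\<^sub>M L \<and>
        (\<forall>x\<in>space L. g (f x) = x) \<and> (\<forall>u\<in>U. f (g u) = u))"

definition diffuse_measure :: "'a measure \<Rightarrow> bool" where
  "diffuse_measure L \<longleftrightarrow> (\<forall>x\<in>space L. emeasure L {x} = 0)"

text \<open>
  Throughout, a measure \<open>L\<close> carries both the measurable space and the reference measure
  \<open>\<lambda>\<close> on it.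
\<close>

definition configs :: "'a measure \<Rightarrow> 'a measure set" where
  "configs L =
     {\<mu>. sets \<mu> = sets L \<and> (\<forall>B\<in>sets L. emeasure L B < \<infinity> \<longrightarrow> emeasure \<mu> B \<in> \<nat>)}"

(* The measurable space of configurations: the sigma-field is generated by the evaluation maps,
   in the same way as for subprob_algebra. *)
definition config_algebra :: "'a measure \<Rightarrow> 'a measure measure" where
  "config_algebra L =
     (SUP A \<in> sets L. vimage_algebra (configs L) (\<lambda>\<mu>. emeasure \<mu> A) borel)"

definition restr_measure :: "'a measure \<Rightarrow> 'a set \<Rightarrow> 'a measure" where
  "restr_measure \<mu> B = density \<mu> (indicator B)"

definition add_measure :: "'a measure \<Rightarrow> 'a measure \<Rightarrow> 'a measure" where
  "add_measure \<mu> \<nu> = measure_of (space \<mu>) (sets \<mu>) (\<lambda>A. emeasure \<mu> A + emeasure \<nu> A)"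

definition add_point :: "'a measure \<Rightarrow> 'a \<Rightarrow> 'a measure" where
  "add_point \<mu> x = add_measure \<mu> (return \<mu> x)"

definition points :: "'a measure \<Rightarrow> 'a set" where
  "points \<mu> = {x \<in> space \<mu>. emeasure \<mu> {x} > 0}"

definition adj_config :: "('a \<Rightarrow> 'a \<Rightarrow> bool) \<Rightarrow> 'a \<Rightarrow> 'a measure \<Rightarrow> bool" where
  "adj_config R x \<mu> \<longleftrightarrow> (\<exists>z\<in>points \<mu>. R x z)"

(* For n = 0 there are no intermediate points and the condition reads R x z. *)
definition connected_via :: "('a \<Rightarrow> 'a \<Rightarrow> bool) \<Rightarrow> 'a measure \<Rightarrow> 'a \<Rightarrow> 'a \<Rightarrow> bool" where
  "connected_via R \<mu> x z \<longleftrightarrow>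
     (\<exists>n. \<exists>p :: nat \<Rightarrow> 'a. p 0 = x \<and> p (n + 1) = z \<and>
        (\<forall>i\<in>{1..n}. p i \<in> points \<mu>) \<and> (\<forall>i\<in>{0..n}. R (p i) (p (i + 1))))"

definition cluster :: "('a \<Rightarrow> 'a \<Rightarrow> bool) \<Rightarrow> 'a \<Rightarrow> 'a measure \<Rightarrow> 'a measure" where
  "cluster R x \<mu> = restr_measure \<mu> {y \<in> space \<mu>. y \<noteq> x \<and> connected_via R \<mu> x y}"

definition point_process :: "'w measure \<Rightarrow> 'a measure \<Rightarrow> ('w \<Rightarrow> 'a measure) \<Rightarrow> bool" where
  "point_process P L \<xi> \<longleftrightarrow> prob_space P \<and> \<xi> \<in> P \<rightarrow>\<^sub>M config_algebra L"

definition gibbs_process ::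
  "'w measure \<Rightarrow> 'a measure \<Rightarrow> ('a \<Rightarrow> 'a measure \<Rightarrow> real) \<Rightarrow> ('w \<Rightarrow> 'a measure) \<Rightarrow> bool" where
  "gibbs_process P L \<kappa> \<xi> \<longleftrightarrow> point_process P L \<xi> \<and>
     (\<forall>f :: 'a \<times> 'a measure \<Rightarrow> real.
        f \<in> borel_measurable (L \<Otimes>\<^sub>M config_algebra L) \<longrightarrow>
        (\<forall>p\<in>space (L \<Otimes>\<^sub>M config_algebra L). 0 \<le> f p) \<longrightarrow>
        (\<integral>\<^sup>+\<omega>. (\<integral>\<^sup>+x. ennreal (f (x, \<xi> \<omega>)) \<partial>(\<xi> \<omega>)) \<partial>P) =
        (\<integral>\<^sup>+\<omega>. (\<integral>\<^sup>+x. ennreal (f (x, add_point (\<xi> \<omega>) x)) * ennreal (\<kappa> x (\<xi> \<omega>)) \<partial>L) \<partial>P))"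

definition cond_prob_given ::
  "'w measure \<Rightarrow> 'b measure \<Rightarrow> ('w \<Rightarrow> 'b) \<Rightarrow> 'w set \<Rightarrow> 'w \<Rightarrow> real" where
  "cond_prob_given P N Y A = real_cond_exp P (vimage_algebra (space P) Y N) (indicator A)"

definition nbhd :: "'a measure \<Rightarrow> ('a \<Rightarrow> 'a \<Rightarrow> bool) \<Rightarrow> 'a \<Rightarrow> 'a set" where
  "nbhd L R x = {y \<in> space L - {x}. R y x}"

definition free_part :: "('a \<Rightarrow> 'a \<Rightarrow> bool) \<Rightarrow> 'a measure \<Rightarrow> 'a set \<Rightarrow> 'a set" where
  "free_part R \<mu> B = {x \<in> B. \<not> adj_config R x (restr_measure \<mu> (space \<mu> - B))}"

lemma space_config_algebra: "space (config_algebra L) = configs L"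
  by (auto simp: config_algebra_def space_Sup_eq_UN)

lemma measurable_emeasure_config_algebra:
  assumes "A \<in> sets L"
  shows "(\<lambda>\<mu>. emeasure \<mu> A) \<in> borel_measurable (config_algebra L)"
  unfolding config_algebra_def using assms
  by (auto intro!: measurable_Sup1 measurable_vimage_algebra1)

lemma emeasure_restr_measure:
  "B \<in> sets \<mu> \<Longrightarrow> A \<in> sets \<mu> \<Longrightarrow> emeasure (restr_measure \<mu> B) A = emeasure \<mu> (B \<inter> A)"
  unfolding restr_measure_def by (rule emeasure_restricted)

lemma sets_add_measure: "sets (add_measure \<mu> \<nu>) = sets \<mu>"
  by (simp add: add_measure_def)

lemma emeasure_add_measure:
  assumes "sets \<nu> = sets \<mu>" and "A \<in> sets \<mu>"
  shows "emeasure (add_measure \<mu> \<nu>) A = emeasure \<mu> A + emeasure \<nu> A"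
  unfolding add_measure_def
proof (rule emeasure_measure_of_sigma[OF sets.sigma_algebra_axioms _ _ assms(2)])
  show "positive (sets \<mu>) (\<lambda>A. emeasure \<mu> A + emeasure \<nu> A)"
    by (simp add: positive_def)
  show "countably_additive (sets \<mu>) (\<lambda>A. emeasure \<mu> A + emeasure \<nu> A)"
  proof (rule countably_additiveI)
    fix F :: "nat \<Rightarrow> 'a set"
    assume F: "range F \<subseteq> sets \<mu>" "disjoint_family F" "\<Union> (range F) \<in> sets \<mu>"
    have "(\<Sum>i. emeasure \<mu> (F i) + emeasure \<nu> (F i)) = (\<Sum>i. emeasure \<mu> (F i)) + (\<Sum>i. emeasure \<nu> (F i))"
      by (intro suminf_add[symmetric] summableI)
    also have "\<dots> = emeasure \<mu> (\<Union> (range F)) + emeasure \<nu> (\<Union> (range F))"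
      using F assms(1) by (simp add: suminf_emeasure)
    finally show "(\<Sum>i. emeasure \<mu> (F i) + emeasure \<nu> (F i)) =
        emeasure \<mu> (\<Union> (range F)) + emeasure \<nu> (\<Union> (range F))" .
  qed
qed

end

theory Submission
  imports Defs
begin

text \<open>
  Let \<open>\<phi>\<close> embed the space into \<open>[0, 1]\<close>. Apply the Gibbs equation to
  \<open>H(\<mu>) K(x, \<mu>) 1{x is the only last point of \<mu> in B}\<close>, where ``last'' refers to the order
  induced by \<open>\<phi>\<close> and \<open>H\<close>, \<open>K(x, \<cdot>)\<close> depend on the configuration outside \<open>B\<close> only. On the right-hand
  side \<open>\<kappa>(x, \<xi>) = \<kappa>(x, 0)\<close> as soon as \<open>x\<close> has no neighbour in \<open>\<xi>\<close> outside \<open>B\<close> and no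
  neighbour in \<open>\<xi>\<close> inside \<open>B\<close>; the latter costs at most the factor
  \<open>exp (- (\<alpha>\<lambda>)(N\<^sub>x \<inter> B))\<close>, since \<open>\<kappa> \<le> \<alpha>\<close>. So the right-hand side is at least
  \<open>E[H \<integral> K(x, \<xi>) 1{\<xi> has no point of B after x} g(x, \<xi>) \<lambda>(dx)]\<close>, with \<open>g\<close> the integrand of the
  theorem. For \<open>K(x, \<mu>) = exp (\<integral> g(y, \<mu>) 1{\<phi> y > \<phi> x} \<lambda>(dy))\<close> the integral is \<open>K(T, \<xi>) - 1\<close> if \<open>T\<close> is
  the last point of \<open>\<xi>\<close> in \<open>B\<close>, and \<open>exp q - 1\<close> with \<open>q = \<integral> g \<lambda>\<close> if \<open>\<xi>(B) = 0\<close>. After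
  cancellation \<open>E[H exp q; \<xi>(B) = 0] \<le> E[H]\<close>, and \<open>H exp q\<close> is an arbitrary test function of the
  configuration outside \<open>B\<close>.
\<close>

subsection \<open>Configurations\<close>

lemma measurable_config_algebraI:
  assumes "\<And>x. x \<in> space M \<Longrightarrow> f x \<in> configs L"
    and "\<And>A. A \<in> sets L \<Longrightarrow> (\<lambda>x. emeasure (f x) A) \<in> borel_measurable M"
  shows "f \<in> M \<rightarrow>\<^sub>M config_algebra L"
  unfolding config_algebra_def using assms
  by (auto intro!: measurable_Sup2 measurable_vimage_algebra2)

lemma configs_sets: "\<mu> \<in> configs L \<Longrightarrow> sets \<mu> = sets L"
  by (simp add: configs_def)

lemma configs_space: "\<mu> \<in> configs L \<Longrightarrow> space \<mu> = space L"
  by (rule sets_eq_imp_space_eq) (rule configs_sets)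

lemma configs_Nats:
  assumes "\<mu> \<in> configs L" "A \<in> sets L" "emeasure L A < \<infinity>"
  shows "emeasure \<mu> A \<in> \<nat>"
  using assms by (auto simp: configs_def)

lemma configs_finite:
  assumes "\<mu> \<in> configs L" "A \<in> sets L" "emeasure L A < \<infinity>"
  shows "emeasure \<mu> A < \<infinity>"
  using configs_Nats[OF assms] by (auto elim!: Nats_cases simp: of_nat_less_top)

lemma null_measure_configs: "null_measure L \<in> configs L"
  by (simp add: configs_def)

lemma restr_measure_configs:
  assumes "\<mu> \<in> configs L" "C \<in> sets L"
  shows "restr_measure \<mu> C \<in> configs L"
proof -
  have "emeasure (restr_measure \<mu> C) A \<in> \<nat>" if A: "A \<in> sets L" "emeasure L A < \<infinity>" for A
  proof -
    have "emeasure L (C \<inter> A) \<le> emeasure L A"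
      using A by (intro emeasure_mono) auto
    then have "emeasure L (C \<inter> A) < \<infinity>"
      using A(2) by simp
    then show ?thesis
      using A assms by (simp add: emeasure_restr_measure configs_sets configs_Nats)
  qed
  then show ?thesis
    using assms by (auto simp: configs_def restr_measure_def)
qed

lemma measurable_restr_measure:
  assumes "C \<in> sets L"
  shows "(\<lambda>\<mu>. restr_measure \<mu> C) \<in> config_algebra L \<rightarrow>\<^sub>M config_algebra L"
proof (rule measurable_config_algebraI)
  fix A assume A: "A \<in> sets L"
  have "(\<lambda>\<mu>. emeasure \<mu> (C \<inter> A)) \<in> borel_measurable (config_algebra L)"
    using A assms by (intro measurable_emeasure_config_algebra) auto
  also have "?this \<longleftrightarrow> (\<lambda>\<mu>. emeasure (restr_measure \<mu> C) A) \<in> borel_measurable (config_algebra L)"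
    using A assms
    by (intro measurable_cong) (simp add: emeasure_restr_measure configs_sets space_config_algebra)
  finally show "(\<lambda>\<mu>. emeasure (restr_measure \<mu> C) A) \<in> borel_measurable (config_algebra L)" .
qed (simp add: restr_measure_configs assms space_config_algebra)

lemma sets_add_point: "sets (add_point \<mu> x) = sets \<mu>"
  by (simp add: add_point_def sets_add_measure)

lemma emeasure_add_point:
  "A \<in> sets \<mu> \<Longrightarrow> emeasure (add_point \<mu> x) A = emeasure \<mu> A + indicator A x"
  by (simp add: add_point_def emeasure_add_measure)

lemma restr_measure_add_point:
  assumes "C \<in> sets \<mu>" "x \<notin> C"
  shows "restr_measure (add_point \<mu> x) C = restr_measure \<mu> C"
proof (rule measure_eqI)
  show "sets (restr_measure (add_point \<mu> x) C) = sets (restr_measure \<mu> C)"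
    by (simp add: restr_measure_def sets_add_point)
  fix A assume "A \<in> sets (restr_measure (add_point \<mu> x) C)"
  then have A: "A \<in> sets \<mu>" by (simp add: restr_measure_def sets_add_point)
  have "C \<inter> A \<in> sets \<mu>" using A assms by auto
  then show "emeasure (restr_measure (add_point \<mu> x) C) A = emeasure (restr_measure \<mu> C) A"
    using A assms
    by (simp add: emeasure_restr_measure sets_add_point emeasure_add_point)
qed

text \<open>A Dynkin class argument in \<open>M\<close>, starting from rectangles. Complements
  require subtracting masses, so the sections are cut down to \<open>C\<close>: as \<open>C\<close>
  has finite \<open>L\<close>-measure, every configuration is finite on it, and one \<open>C\<close>
  serves all pairs (x, \<mu>).\<close>

lemma measurable_emeasure_section_finite:
  assumes C: "C \<in> sets L" "emeasure L C < \<infinity>" and M: "M \<in> sets (L \<Otimes>\<^sub>M L)"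
  shows "(\<lambda>(x, \<mu>). emeasure \<mu> (C \<inter> Pair x -` M)) \<in> borel_measurable (L \<Otimes>\<^sub>M config_algebra L)"
    (is "?P M")
proof -
  have meas: "(\<lambda>p. emeasure (snd p) A) \<in> borel_measurable (L \<Otimes>\<^sub>M config_algebra L)"
    if "A \<in> sets L" for A
    using measurable_compose[OF measurable_snd measurable_emeasure_config_algebra[OF that]] .
  have sp: "\<mu> \<in> configs L" "x \<in> space L"
    if "(x, \<mu>) \<in> space (L \<Otimes>\<^sub>M config_algebra L)" for x \<mu>
    using that by (auto simp: space_pair_measure space_config_algebra)
  have sect: "Pair x -` N \<in> sets \<mu>" if "N \<in> sets (L \<Otimes>\<^sub>M L)" "\<mu> \<in> configs L" for x \<mu> N
    using sets_Pair1[OF that(1)] that(2) by (simp add: configs_sets)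
  have pair_sets: "sets (L \<Otimes>\<^sub>M L) =
      sigma_sets (space L \<times> space L) {a \<times> b |a b. a \<in> sets L \<and> b \<in> sets L}"
    by (rule sets_pair_measure)
  have M': "M \<in> sigma_sets (space L \<times> space L) {a \<times> b |a b. a \<in> sets L \<and> b \<in> sets L}"
    using M by (simp add: pair_sets)
  show "?P M"
  proof (rule sigma_sets_induct_disjoint[OF Int_stable_pair_measure_generator pair_measure_closed M'],
      goal_cases)
    case (1 A)
    then obtain a b where A: "A = a \<times> b" "a \<in> sets L" "b \<in> sets L" by auto
    have eq: "(\<lambda>(x, \<mu>). emeasure \<mu> (C \<inter> Pair x -` A)) =
      (\<lambda>p. emeasure (snd p) (C \<inter> b) * indicator a (fst p))"
      by (auto simp: A fun_eq_iff indicator_def Int_def)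
    show ?case
      unfolding eq using A C
      by (intro borel_measurable_times_ennreal meas
          measurable_compose[OF measurable_fst borel_measurable_indicator]) auto
  next
    case 2
    then show ?case by (simp add: case_prod_unfold)
  next
    case (3 A)
    have A: "A \<in> sets (L \<Otimes>\<^sub>M L)" using 3 by (simp add: pair_sets)
    have "(\<lambda>p. emeasure (snd p) C - (case p of (x, \<mu>) \<Rightarrow> emeasure \<mu> (C \<inter> Pair x -` A)))
      \<in> borel_measurable (L \<Otimes>\<^sub>M config_algebra L)"
      using 3 C by (intro borel_measurable_minus_ennreal meas) auto
    also have "?this \<longleftrightarrow> ?case"
    proof (rule measurable_cong)
      fix p assume p: "p \<in> space (L \<Otimes>\<^sub>M config_algebra L)"
      obtain x \<mu> where p': "p = (x, \<mu>)" by (cases p)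
      note x = sp[OF p[unfolded p']]
      have "C \<inter> Pair x -` (space L \<times> space L - A) = C - (C \<inter> Pair x -` A)"
        using C(1)[THEN sets.sets_into_space] x by auto
      moreover have "emeasure \<mu> (C \<inter> Pair x -` A) \<noteq> \<infinity>"
      proof -
        have "emeasure \<mu> (C \<inter> Pair x -` A) \<le> emeasure \<mu> C"
          using C x by (intro emeasure_mono) (auto simp: configs_sets)
        then show ?thesis
          using configs_finite[OF x(1) C] by (auto simp: top_unique)
      qed
      ultimately show "emeasure (snd p) C - (case p of (x, \<mu>) \<Rightarrow> emeasure \<mu> (C \<inter> Pair x -` A)) =
        (case p of (x, \<mu>) \<Rightarrow> emeasure \<mu> (C \<inter> Pair x -` (space L \<times> space L - A)))"
        using C sect[OF A x(1), of x] configs_sets[OF x(1)] by (simp add: p' emeasure_Diff)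
    qed
    finally show ?case .
  next
    case (4 A)
    have A: "A i \<in> sets (L \<Otimes>\<^sub>M L)" for i using 4 by (auto simp: pair_sets)
    have "(\<lambda>p. \<Sum>i. (case p of (x, \<mu>) \<Rightarrow> emeasure \<mu> (C \<inter> Pair x -` A i)))
      \<in> borel_measurable (L \<Otimes>\<^sub>M config_algebra L)"
      using 4 by (intro borel_measurable_suminf_order) auto
    also have "?this \<longleftrightarrow> ?case"
    proof (rule measurable_cong)
      fix p assume p: "p \<in> space (L \<Otimes>\<^sub>M config_algebra L)"
      obtain x \<mu> where p': "p = (x, \<mu>)" by (cases p)
      note x = sp[OF p[unfolded p']]
      have "(\<Sum>i. emeasure \<mu> (C \<inter> Pair x -` A i)) = emeasure \<mu> (\<Union>i. C \<inter> Pair x -` A i)"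
        using 4(1) C sect[OF A x(1)] configs_sets[OF x(1)]
        by (intro suminf_emeasure) (auto simp: disjoint_family_on_def)
      also have "(\<Union>i. C \<inter> Pair x -` A i) = C \<inter> Pair x -` (\<Union>i. A i)" by auto
      finally show "(\<Sum>i. (case p of (x, \<mu>) \<Rightarrow> emeasure \<mu> (C \<inter> Pair x -` A i))) =
        (case p of (x, \<mu>) \<Rightarrow> emeasure \<mu> (C \<inter> Pair x -` (\<Union>i. A i)))"
        by (simp add: p')
    qed
    finally show ?case .
  qed
qed

text \<open>A configuration may have infinite total mass, so the section is split along a countable
  partition of the space into sets of finite \<open>L\<close>-measure and the masses are
  summed.\<close>

lemma measurable_emeasure_section:
  assumes "sigma_finite_measure L" and M: "M \<in> sets (L \<Otimes>\<^sub>M L)"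
  shows "(\<lambda>(x, \<mu>). emeasure \<mu> (Pair x -` M)) \<in> borel_measurable (L \<Otimes>\<^sub>M config_algebra L)"
proof -
  interpret sigma_finite_measure L by fact
  obtain C :: "nat \<Rightarrow> 'a set" where C: "range C \<subseteq> sets L" "(\<Union>i. C i) = space L"
    "\<And>i. emeasure L (C i) \<noteq> \<infinity>" "disjoint_family C"
    using sigma_finite_disjoint by metis
  have "(\<lambda>p. \<Sum>i. (case p of (x, \<mu>) \<Rightarrow> emeasure \<mu> (C i \<inter> Pair x -` M)))
      \<in> borel_measurable (L \<Otimes>\<^sub>M config_algebra L)"
    using C M
    by (intro borel_measurable_suminf_order measurable_emeasure_section_finite) (auto simp: less_top)
  also have "?this \<longleftrightarrow> ?thesis"
  proof (rule measurable_cong)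
    fix p assume p: "p \<in> space (L \<Otimes>\<^sub>M config_algebra L)"
    obtain x \<mu> where p': "p = (x, \<mu>)" by (cases p)
    have \<mu>: "\<mu> \<in> configs L"
      using p by (auto simp: p' space_pair_measure space_config_algebra)
    have s: "Pair x -` M \<in> sets L" using M by (rule sets_Pair1)
    have "(\<Sum>i. emeasure \<mu> (C i \<inter> Pair x -` M)) = emeasure \<mu> (\<Union>i. C i \<inter> Pair x -` M)"
      using C s configs_sets[OF \<mu>]
      by (intro suminf_emeasure) (fastforce simp: disjoint_family_on_def)+
    also have "(\<Union>i. C i \<inter> Pair x -` M) = Pair x -` M"
      using C(2) sets.sets_into_space[OF s] by auto
    finally show "(\<Sum>i. (case p of (x, \<mu>) \<Rightarrow> emeasure \<mu> (C i \<inter> Pair x -` M))) =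
        (case p of (x, \<mu>) \<Rightarrow> emeasure \<mu> (Pair x -` M))"
      by (simp add: p')
  qed
  finally show ?thesis .
qed

text \<open>Configurations are given as integer-valued measures rather than as sums of point masses,
  so the point has to be produced. The mass of {\<phi> \<ge> t} in \<open>A\<close> is decreasing in
  t and integer-valued. At the supremum \<open>T\<close> of the levels where it is positive it is
  still at least 1 by continuity from above, while no mass lies strictly above \<open>T\<close>. So
  the level set at \<open>T\<close> has positive mass, and injectivity of \<phi> makes it a single
  point.\<close>

lemma last_atom:
  fixes \<phi> :: "'a \<Rightarrow> real"
  assumes \<phi>: "\<phi> \<in> borel_measurable L" "inj_on \<phi> (space L)" "\<phi> ` space L \<subseteq> {0..1}"
    and \<mu>: "\<mu> \<in> configs L" and A: "A \<in> sets L" "emeasure L A < \<infinity>" and pos: "emeasure \<mu> A \<noteq> 0"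
  obtains x where "x \<in> A" "emeasure \<mu> {x} \<noteq> 0" "emeasure \<mu> {y \<in> A. \<phi> x < \<phi> y} = 0"
proof -
  have sA: "A \<subseteq> space L" using A by (simp add: sets.sets_into_space)
  have [measurable]: "\<phi> \<in> borel_measurable L" "A \<in> sets L" by fact+
  have [simp]: "sets \<mu> = sets L" using \<mu> by (rule configs_sets)
  have set1: "{y \<in> A. P (\<phi> y)} \<in> sets L" if [measurable]: "Measurable.pred borel P" for P
  proof -
    have "{y \<in> A. P (\<phi> y)} = A \<inter> {y \<in> space L. P (\<phi> y)}" using sA by auto
    also have "\<dots> \<in> sets L" by measurable
    finally show ?thesis .
  qed
  have fin: "emeasure L C < \<infinity>" if "C \<subseteq> A" for C
    using emeasure_mono[OF that A(1)] A(2) by simp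
  define F where "F t = emeasure \<mu> {y \<in> A. t \<le> \<phi> y}" for t
  have F_sets: "{y \<in> A. t \<le> \<phi> y} \<in> sets L" for t by (rule set1) simp
  have F_nat: "F t \<in> \<nat>" for t
    unfolding F_def by (intro configs_Nats[OF \<mu> F_sets] fin) auto
  \<comment> \<open>Integrality enters here: the gap between 0 and 1 is what survives the limit at
    \<open>T\<close>.\<close>
  have F_less: "F t = 0" if "\<not> F t \<ge> 1" for t
    using F_nat[of t] that
  proof (cases rule: Nats_cases)
    case (of_nat n)
    then show ?thesis using that by (cases n) auto
  qed
  have F_mono: "F t \<le> F s" if "s \<le> t" for s t
    unfolding F_def using that F_sets by (intro emeasure_mono) auto
  define S where "S = {t. F t \<ge> 1}"
  have "{y \<in> A. 0 \<le> \<phi> y} = A" using \<phi>(3) sA by fastforce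
  then have "F 0 \<noteq> 0" using pos by (simp add: F_def)
  then have S0: "0 \<in> S" using F_less[of 0] by (auto simp: S_def)
  have bdd: "bdd_above S"
  proof (rule bdd_aboveI)
    fix t assume "t \<in> S"
    show "t \<le> 1"
    proof (rule ccontr)
      assume "\<not> t \<le> 1"
      then have "{y \<in> A. t \<le> \<phi> y} = {}" using \<phi>(3) sA by fastforce
      then have "F t = 0" by (simp only: F_def emeasure_empty)
      then show False using \<open>t \<in> S\<close> by (simp add: S_def)
    qed
  qed
  define T where "T = Sup S"
  have below: "F t \<ge> 1" if "t < T" for t
  proof -
    have "\<exists>s\<in>S. t < s" using that S0 less_cSup_iff[OF _ bdd, of t] by (auto simp: T_def)
    then obtain s where "1 \<le> F s" "t < s" by (auto simp: S_def)
    then show ?thesis using F_mono[of t s] by (simp add: order_trans[of 1 "F s"])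
  qed
  have above: "F t = 0" if "T < t" for t
    using that cSup_upper[OF _ bdd, of t] by (intro F_less) (auto simp: T_def S_def)
  have eqT: "{y \<in> A. T \<le> \<phi> y} = (\<Inter>n. {y \<in> A. T - 1 / Suc n \<le> \<phi> y})"
  proof (intro antisym subsetI)
    fix y assume y: "y \<in> (\<Inter>n. {y \<in> A. T - 1 / Suc n \<le> \<phi> y})"
    have "T \<le> \<phi> y"
    proof (rule ccontr)
      assume "\<not> T \<le> \<phi> y"
      then obtain n where "inverse (of_nat (Suc n)) < T - \<phi> y"
        using reals_Archimedean[of "T - \<phi> y"] by auto
      moreover have "T - 1 / Suc n \<le> \<phi> y" using y by auto
      ultimately show False by (simp add: inverse_eq_divide)
    qed
    then show "y \<in> {y \<in> A. T \<le> \<phi> y}" using y by auto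
  qed (auto intro: order_trans[of _ T])
  have "F T = (INF n. F (T - 1 / Suc n))"
    unfolding F_def eqT
  proof (rule INF_emeasure_decseq[symmetric])
    show "decseq (\<lambda>n. {y \<in> A. T - 1 / Suc n \<le> \<phi> y})"
    proof (intro decseq_SucI subsetI)
      fix n y assume y: "y \<in> {y \<in> A. T - 1 / Suc (Suc n) \<le> \<phi> y}"
      have "1 / real (Suc (Suc n)) \<le> 1 / real (Suc n)" by (simp add: frac_le)
      with y show "y \<in> {y \<in> A. T - 1 / Suc n \<le> \<phi> y}" by (auto simp del: of_nat_Suc)
    qed
    show "emeasure \<mu> {y \<in> A. T - 1 / Suc n \<le> \<phi> y} \<noteq> \<infinity>" for n
      using configs_finite[OF \<mu> F_sets fin, of "T - 1 / Suc n"] by simp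
  qed (use F_sets in auto)
  also have "\<dots> \<ge> 1" by (intro INF_greatest below) simp
  finally have FT: "F T \<ge> 1" .
  have gt: "emeasure \<mu> {y \<in> A. T < \<phi> y} = 0"
  proof -
    have eq: "{y \<in> A. T < \<phi> y} = (\<Union>n. {y \<in> A. T + 1 / Suc n \<le> \<phi> y})"
    proof (intro antisym subsetI)
      fix y assume y: "y \<in> {y \<in> A. T < \<phi> y}"
      then obtain n where "inverse (of_nat (Suc n)) < \<phi> y - T"
        using reals_Archimedean[of "\<phi> y - T"] by auto
      then show "y \<in> (\<Union>n. {y \<in> A. T + 1 / Suc n \<le> \<phi> y})"
        using y by (auto intro!: exI[of _ n] simp: inverse_eq_divide)
    next
      fix y assume "y \<in> (\<Union>n. {y \<in> A. T + 1 / Suc n \<le> \<phi> y})"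
      then obtain n where "y \<in> A" "T + 1 / Suc n \<le> \<phi> y" by auto
      moreover have "0 < 1 / real (Suc n)" by simp
      ultimately have "T < \<phi> y" by linarith
      then show "y \<in> {y \<in> A. T < \<phi> y}" using \<open>y \<in> A\<close> by simp
    qed
    show ?thesis
      unfolding eq using above[unfolded F_def] F_sets by (intro emeasure_UN_eq_0) auto
  qed
  have "F T = emeasure \<mu> ({y \<in> A. \<phi> y = T} \<union> {y \<in> A. T < \<phi> y})"
    unfolding F_def by (intro arg_cong[where f="emeasure \<mu>"]) auto
  also have "\<dots> \<le> emeasure \<mu> {y \<in> A. \<phi> y = T} + emeasure \<mu> {y \<in> A. T < \<phi> y}"
    using set1[of "\<lambda>t. t = T"] set1[of "\<lambda>t. T < t"] by (intro emeasure_subadditive) auto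
  finally have pT: "emeasure \<mu> {y \<in> A. \<phi> y = T} \<noteq> 0"
    using FT gt by auto
  then have "{y \<in> A. \<phi> y = T} \<noteq> {}" by (intro notI) simp
  then obtain x where x: "x \<in> A" "\<phi> x = T" by auto
  have "{y \<in> A. \<phi> y = T} = {x}"
    using x sA inj_onD[OF \<phi>(2)] by blast
  then show thesis using that[of x] x pT gt by auto
qed

subsection \<open>Exponential of an atomless tail\<close>

text \<open>The levels whose upper mass is at most s form an up-set, hence a half-line if there are
  any. Up to its end point, whose level set is null, the half-line is an increasing union of rays
  starting at points of the half-line itself, and the preimage of each such ray has mass at most
  s.\<close>

lemma emeasure_upper_set_le:
  fixes \<phi> :: "'a \<Rightarrow> real"
  assumes "finite_measure N" and [measurable]: "\<phi> \<in> borel_measurable N"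
    and atomless: "\<And>t. emeasure N {y \<in> space N. \<phi> y = t} = 0" and s: "0 \<le> s"
  shows "emeasure N {x \<in> space N. measure N {y \<in> space N. \<phi> x < \<phi> y} \<le> s} \<le> ennreal s"
proof -
  interpret finite_measure N by fact
  define F where "F t = measure N {y \<in> space N. t < \<phi> y}" for t
  have anti: "F t \<le> F u" if "u \<le> t" for t u
    unfolding F_def using that by (intro finite_measure_mono) auto
  define S where "S = {t. F t \<le> s}"
  have up: "t \<in> S" if "u \<in> S" "u \<le> t" for t u
    using that anti[of u t] by (auto simp: S_def)
  have "{x \<in> space N. F (\<phi> x) \<le> s} = {x \<in> space N. \<phi> x \<in> S}" by (simp add: S_def)
  moreover have "emeasure N {x \<in> space N. \<phi> x \<in> S} \<le> ennreal s"
  proof -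
    \<comment> \<open>Here \<open>c\<close> is the possible end point of \<open>S\<close>, and
      \<open>u\<close> runs downwards through \<open>S\<close> below every other element. Discarding
      the null level \<open>c\<close> makes it irrelevant whether the half-line is open or
      closed.\<close>
    have bound: "emeasure N {x \<in> space N. \<phi> x \<in> S} \<le> ennreal s"
      if u: "\<And>n. u n \<in> S" "decseq u" and sub: "\<And>t. t \<in> S \<Longrightarrow> t \<noteq> c \<Longrightarrow> \<exists>n. u n < t"
      for u :: "nat \<Rightarrow> real" and c
    proof -
      have "emeasure N {x \<in> space N. \<phi> x \<in> S} \<le>
          emeasure N ({x \<in> space N. \<phi> x = c} \<union> (\<Union>n. {y \<in> space N. u n < \<phi> y}))"
        using sub by (intro emeasure_mono) auto
      also have "\<dots> \<le> emeasure N {x \<in> space N. \<phi> x = c} + emeasure N (\<Union>n. {y \<in> space N. u n < \<phi> y})"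
        by (intro emeasure_subadditive) auto
      also have "\<dots> = emeasure N (\<Union>n. {y \<in> space N. u n < \<phi> y})" by (simp add: atomless)
      also have "\<dots> = (SUP n. emeasure N {y \<in> space N. u n < \<phi> y})"
        using u(2) by (intro SUP_emeasure_incseq[symmetric])
          (auto simp: incseq_def decseq_def intro: le_less_trans)
      also have "\<dots> \<le> ennreal s"
        using u(1) s by (intro SUP_least) (auto simp: S_def F_def emeasure_eq_measure)
      finally show ?thesis .
    qed
    show ?thesis
    proof (cases "S = {} \<or> \<not> bdd_below S")
      case True
      then show ?thesis
      proof
        assume S: "\<not> bdd_below S"
        have inS: "t \<in> S" for t
        proof -
          obtain u where "u \<in> S" "u < t" using S by (auto simp: bdd_below_def not_le)
          then show ?thesis using up by auto
        qed
        show ?thesis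
        \<comment> \<open>\<open>S\<close> is the whole line and has no end point; 0 is a dummy
          value for \<open>c\<close>.\<close>
        proof (rule bound[where c = 0 and u = "\<lambda>n. - real n"])
          fix t :: real
          show "\<exists>n. - real n < t"
            using reals_Archimedean2[of "- t"] by (auto intro: exI simp: minus_less_iff)
        qed (use inS in \<open>auto simp: decseq_def\<close>)
      qed auto
    next
      case False
      define c where "c = Inf S"
      have gt: "t \<in> S" if "c < t" for t
      proof -
        have "\<exists>u\<in>S. u < t"
          using that False cInf_less_iff[of S t] by (simp add: c_def)
        then show ?thesis using up by auto
      qed
      have ge: "c \<le> t" if "t \<in> S" for t
        using that False by (auto simp: c_def intro: cInf_lower)
      show ?thesis
      proof (rule bound[where c = c and u = "\<lambda>n. c + 1 / Suc n"])
        show "decseq (\<lambda>n. c + 1 / real (Suc n))"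
          by (intro decseq_SucI) (simp add: field_simps)
        fix t assume "t \<in> S" "t \<noteq> c"
        then have "0 < t - c" using ge[of t] by simp
        then show "\<exists>n. c + 1 / real (Suc n) < t"
          using reals_Archimedean[of "t - c"] by (simp add: inverse_eq_divide algebra_simps)
      qed (simp add: gt)
    qed
  qed
  ultimately show ?thesis by (simp add: F_def)
qed

text \<open>This is e^r = 1 + (integral of e^s over 0 \<le> s \<le> r), with the range split into
  the fixed factor \<open>{0..m}\<close> and the strict condition s < r. For r = F x the latter is
  the event {s < F x}, which is the form needed to exchange integrals; strictness costs only the
  null point s = r.\<close>

lemma ennreal_exp_eq_nn_integral:
  assumes "0 \<le> r" "r \<le> m"
  shows "ennreal (exp r) = 1 + (\<integral>\<^sup>+s. ennreal (exp s) * indicator {0..m} s * indicator {..<r} s \<partial>lborel)"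
proof -
  have "(\<integral>\<^sup>+s. ennreal (exp s) * indicator {0..r} s \<partial>lborel) = ennreal (exp r - exp 0)"
    using assms by (intro nn_integral_FTC_Icc) (auto intro!: derivative_eq_intros)
  moreover have "(\<integral>\<^sup>+s. ennreal (exp s) * indicator {0..m} s * indicator {..<r} s \<partial>lborel) =
    (\<integral>\<^sup>+s. ennreal (exp s) * indicator {0..r} s \<partial>lborel)"
  proof (rule nn_integral_cong_AE)
    show "AE s in lborel. ennreal (exp s) * indicator {0..m} s * indicator {..<r} s =
        ennreal (exp s) * indicator {0..r} s"
      using AE_lborel_singleton[of r]
    proof eventually_elim
      case (elim s)
      then show ?case using assms by (auto simp: indicator_def)
    qed
  qed
  ultimately have "(\<integral>\<^sup>+s. ennreal (exp s) * indicator {0..m} s * indicator {..<r} s \<partial>lborel) =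
    ennreal (exp r - 1)" by simp
  moreover have "ennreal (exp r) = ennreal 1 + ennreal (exp r - 1)"
    using assms by (subst ennreal_plus[symmetric]) auto
  ultimately show ?thesis by simp
qed

text \<open>
  Layer cake formula: by the preceding lemma the upper mass \<open>N {y. \<phi> x < \<phi> y}\<close> stochastically
  dominates the uniform distribution, for which equality holds.
\<close>

lemma exp_minus_one_le_nn_integral:
  fixes \<phi> :: "'a \<Rightarrow> real"
  assumes "finite_measure N" and [measurable]: "\<phi> \<in> borel_measurable N"
    and atomless: "\<And>t. emeasure N {y \<in> space N. \<phi> y = t} = 0"
  shows "ennreal (exp (measure N (space N)) - 1) \<le>
    (\<integral>\<^sup>+x. ennreal (exp (measure N {y \<in> space N. \<phi> x < \<phi> y})) \<partial>N)"
proof -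
  interpret finite_measure N by fact
  interpret N2: pair_sigma_finite lborel N ..
  define m where "m = measure N (space N)"
  define F where "F x = measure N {y \<in> space N. \<phi> x < \<phi> y}" for x
  \<comment> \<open>The upper mass is a decreasing function of the level composed with \<phi>, so
    its measurability follows from monotonicity.\<close>
  have anti: "antimono (\<lambda>t. measure N {y \<in> space N. t < \<phi> y})"
    by (intro antimonoI finite_measure_mono) auto
  have "(\<lambda>t. - measure N {y \<in> space N. t < \<phi> y}) \<in> borel_measurable borel"
    using anti by (intro borel_measurable_mono monoI) (simp add: monotone_def)
  then have "(\<lambda>t. measure N {y \<in> space N. t < \<phi> y}) \<in> borel_measurable borel" by simp
  then have [measurable]: "F \<in> borel_measurable N"
    unfolding F_def by (rule measurable_compose[rotated]) simp
  have F: "0 \<le> F x" "F x \<le> m" for x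
    unfolding F_def m_def by (auto intro: bounded_measure)
  have m0: "0 \<le> m" by (simp add: m_def)
  have tail: "ennreal (m - s) \<le> emeasure N {x \<in> space N. s < F x}" if "0 \<le> s" for s
  proof -
    have "ennreal m = emeasure N (space N)" by (simp add: m_def emeasure_eq_measure)
    also have "\<dots> = emeasure N ({x \<in> space N. s < F x} \<union> {x \<in> space N. F x \<le> s})"
      by (intro arg_cong[where f="emeasure N"]) auto
    also have "\<dots> \<le> emeasure N {x \<in> space N. s < F x} + emeasure N {x \<in> space N. F x \<le> s}"
      by (intro emeasure_subadditive) auto
    also have "\<dots> \<le> emeasure N {x \<in> space N. s < F x} + ennreal s"
      using emeasure_upper_set_le[OF assms that] by (intro add_left_mono) (simp add: F_def)
    finally have "ennreal m - ennreal s \<le> emeasure N {x \<in> space N. s < F x} + ennreal s - ennreal s"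
      by (rule ennreal_minus_mono) simp
    then show ?thesis using that by (simp add: ennreal_minus)
  qed
  \<comment> \<open>The layer cake integral for an upper mass that is uniform on [0, m]; the
    antiderivative used is \<open>exp s * (m - s + 1)\<close>.\<close>
  have "(\<integral>\<^sup>+s. ennreal (exp s * (m - s)) * indicator {0..m} s \<partial>lborel) =
      ennreal (exp m * (m - m + 1) - exp 0 * (m - 0 + 1))"
    using m0
    by (intro nn_integral_FTC_Icc) (auto intro!: derivative_eq_intros simp: algebra_simps)
  then have "(\<integral>\<^sup>+s. ennreal (exp s * (m - s)) * indicator {0..m} s \<partial>lborel) = ennreal (exp m - 1 - m)"
    by (simp add: algebra_simps)
  moreover have "0 \<le> exp m - 1 - m" using exp_ge_add_one_self[of m] by linarith
  ultimately have "ennreal (exp m - 1) =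
      ennreal m + (\<integral>\<^sup>+s. ennreal (exp s * (m - s)) * indicator {0..m} s \<partial>lborel)"
    using m0 by (simp add: ennreal_plus[symmetric] del: ennreal_plus)
  also have "\<dots> \<le> ennreal m + (\<integral>\<^sup>+s. ennreal (exp s) * indicator {0..m} s * emeasure N {x \<in> space N. s < F x} \<partial>lborel)"
  proof (intro add_left_mono nn_integral_mono)
    fix s :: real
    show "ennreal (exp s * (m - s)) * indicator {0..m} s \<le>
      ennreal (exp s) * indicator {0..m} s * emeasure N {x \<in> space N. s < F x}"
      using tail[of s] by (auto simp: indicator_def ennreal_mult' intro!: mult_left_mono)
  qed
  also have "\<dots> = (\<integral>\<^sup>+x. 1 \<partial>N) +
      (\<integral>\<^sup>+s. (\<integral>\<^sup>+x. ennreal (exp s) * indicator {0..m} s * indicator {..<F x} s \<partial>N) \<partial>lborel)"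
  proof (intro arg_cong2[where f="(+)"] nn_integral_cong)
    fix s :: real
    have "(\<integral>\<^sup>+x. ennreal (exp s) * indicator {0..m} s * indicator {..<F x} s \<partial>N) =
      (\<integral>\<^sup>+x. ennreal (exp s) * indicator {0..m} s * indicator {x \<in> space N. s < F x} x \<partial>N)"
      by (intro nn_integral_cong) (auto simp: indicator_def)
    then show "ennreal (exp s) * indicator {0..m} s * emeasure N {x \<in> space N. s < F x} =
      (\<integral>\<^sup>+x. ennreal (exp s) * indicator {0..m} s * indicator {..<F x} s \<partial>N)"
      by (simp add: nn_integral_cmult_indicator)
  qed (simp add: m_def emeasure_eq_measure)
  also have "(\<integral>\<^sup>+s. (\<integral>\<^sup>+x. ennreal (exp s) * indicator {0..m} s * indicator {..<F x} s \<partial>N) \<partial>lborel) =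
      (\<integral>\<^sup>+x. (\<integral>\<^sup>+s. ennreal (exp s) * indicator {0..m} s * indicator {..<F x} s \<partial>lborel) \<partial>N)"
  proof (rule N2.Fubini'[symmetric])
    have "(\<lambda>(s, x). ennreal (exp s) * indicator {0..m} s * (if s < F x then 1 else 0))
      \<in> borel_measurable (lborel \<Otimes>\<^sub>M N)" by measurable
    then show "(\<lambda>(s, x). ennreal (exp s) * indicator {0..m} s * indicator {..<F x} s)
      \<in> borel_measurable (lborel \<Otimes>\<^sub>M N)"
      by (simp add: indicator_def)
  qed
  also have "(\<integral>\<^sup>+x. 1 \<partial>N) + \<dots> =
      (\<integral>\<^sup>+x. 1 + (\<integral>\<^sup>+s. ennreal (exp s) * indicator {0..m} s * indicator {..<F x} s \<partial>lborel) \<partial>N)"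
  proof (rule nn_integral_add[symmetric])
    have "(\<lambda>x. \<integral>\<^sup>+s. ennreal (exp s) * indicator {0..m} s * (if s < F x then 1 else 0) \<partial>lborel)
      \<in> borel_measurable N" by measurable
    then show "(\<lambda>x. \<integral>\<^sup>+s. ennreal (exp s) * indicator {0..m} s * indicator {..<F x} s \<partial>lborel)
      \<in> borel_measurable N"
      by (simp add: indicator_def)
  qed simp
  also have "\<dots> = (\<integral>\<^sup>+x. ennreal (exp (F x)) \<partial>N)"
    using F by (intro nn_integral_cong ennreal_exp_eq_nn_integral[symmetric])
  finally show ?thesis by (simp add: m_def F_def)
qed

subsection \<open>Conditional expectations\<close>

text \<open>The hypothesis is tested on the set \<open>S\<close> where the conditional expectation
  exceeds \<open>r\<close>. It belongs to \<open>F\<close>, and there the difference is positive but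
  has integral at most 0, so \<open>S\<close> is null.\<close>

lemma (in finite_measure_subalgebra) real_cond_exp_leI:
  assumes f: "integrable M f" and r: "r \<in> borel_measurable F" "integrable M r"
    and le: "\<And>S. S \<in> sets F \<Longrightarrow> (\<integral>x\<in>S. f x \<partial>M) \<le> (\<integral>x\<in>S. r x \<partial>M)"
  shows "AE x in M. real_cond_exp M F f x \<le> r x"
proof -
  have [measurable]: "r \<in> borel_measurable F" by fact
  define p where "p = real_cond_exp M F f"
  have [measurable]: "p \<in> borel_measurable F" by (simp add: p_def)
  have p: "integrable M p" using f by (simp add: p_def real_cond_exp_int)
  define S where "S = {x \<in> space F. r x < p x}"
  have S: "S \<in> sets F" unfolding S_def by measurable
  then have SM: "S \<in> sets M" using subalg by (auto simp: subalgebra_def)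
  have int: "integrable M (\<lambda>x. indicator S x * p x)" "integrable M (\<lambda>x. indicator S x * r x)"
    using integrable_mult_indicator[OF SM p] integrable_mult_indicator[OF SM r(2)] by simp_all
  have "(\<integral>x\<in>S. p x \<partial>M) \<le> (\<integral>x\<in>S. r x \<partial>M)"
    using le[OF S] real_cond_exp_intA[OF f S] by (simp add: p_def)
  then have le0: "(\<integral>x. indicator S x * p x - indicator S x * r x \<partial>M) \<le> 0"
    using int by (simp add: set_lebesgue_integral_def)
  have pos: "0 \<le> indicator S x * p x - indicator S x * r x" for x
    by (auto simp: S_def indicator_def)
  have "(\<integral>x. indicator S x * p x - indicator S x * r x \<partial>M) = 0"
    using le0 pos by (intro antisym integral_nonneg) auto
  then have "AE x in M. indicator S x * p x - indicator S x * r x = 0"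
    using int pos by (subst (asm) integral_nonneg_eq_0_iff_AE) auto
  then show ?thesis
  proof (rule AE_mp, intro AE_I2 impI)
    fix x assume "x \<in> space M" "indicator S x * p x - indicator S x * r x = 0"
    moreover have "space F = space M" using subalg by (simp add: subalgebra_def)
    ultimately show "real_cond_exp M F f x \<le> r x"
      by (auto simp: S_def p_def indicator_def split: if_splits)
  qed
qed

subsection \<open>Void probabilities of dominated Gibbs processes\<close>

text \<open>Collects what the comparison of void probabilities rests on: the Gibbs equation and a
  locally finite dominating density. The relation, the region and the order are added in a second
  locale.\<close>

locale dominated_gibbs = P: prob_space P + L: sigma_finite_measure L
  for P :: "'w measure" and L :: "'a measure" +
  fixes \<kappa> :: "'a \<Rightarrow> 'a measure \<Rightarrow> real" and \<alpha> :: "'a \<Rightarrow> real" and \<xi> :: "'w \<Rightarrow> 'a measure"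
  assumes kappa_measurable: "(\<lambda>(x, \<mu>). \<kappa> x \<mu>) \<in> borel_measurable (L \<Otimes>\<^sub>M config_algebra L)"
    and kappa_nonneg: "\<And>x \<mu>. x \<in> space L \<Longrightarrow> \<mu> \<in> configs L \<Longrightarrow> 0 \<le> \<kappa> x \<mu>"
    and kappa_le: "\<And>x \<mu>. x \<in> space L \<Longrightarrow> \<mu> \<in> configs L \<Longrightarrow> \<kappa> x \<mu> \<le> \<alpha> x"
    and alpha_measurable [measurable]: "\<alpha> \<in> borel_measurable L"
    and alpha_locally_finite:
      "\<And>A. A \<in> sets L \<Longrightarrow> emeasure L A < \<infinity> \<Longrightarrow> (\<integral>\<^sup>+x\<in>A. ennreal (\<alpha> x) \<partial>L) < \<infinity>"
    and gibbs: "gibbs_process P L \<kappa> \<xi>"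
begin

definition dom :: "'a measure" where
  "dom = density L (\<lambda>x. ennreal (\<alpha> x))"

lemma sets_dom [simp]: "sets dom = sets L"
  by (simp add: dom_def)

lemma emeasure_dom: "A \<in> sets L \<Longrightarrow> emeasure dom A = (\<integral>\<^sup>+x\<in>A. ennreal (\<alpha> x) \<partial>L)"
  by (simp add: dom_def emeasure_density)

lemma emeasure_dom_finite:
  "A \<in> sets L \<Longrightarrow> emeasure L A < \<infinity> \<Longrightarrow> emeasure dom A = ennreal (measure dom A)"
  using alpha_locally_finite[of A] by (simp add: emeasure_dom measure_def)

lemma alpha_nonneg: "x \<in> space L \<Longrightarrow> 0 \<le> \<alpha> x"
  using kappa_nonneg[OF _ null_measure_configs] kappa_le[OF _ null_measure_configs] by force

lemma xi_measurable [measurable]: "\<xi> \<in> P \<rightarrow>\<^sub>M config_algebra L"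
  using gibbs by (simp add: gibbs_process_def point_process_def)

lemma xi_configs: "\<omega> \<in> space P \<Longrightarrow> \<xi> \<omega> \<in> configs L"
  using measurable_space[OF xi_measurable] by (simp add: space_config_algebra)

lemma xi_emeasure_measurable [measurable (raw)]:
  "A \<in> sets L \<Longrightarrow> (\<lambda>\<omega>. emeasure (\<xi> \<omega>) A) \<in> borel_measurable P"
  using measurable_compose[OF xi_measurable measurable_emeasure_config_algebra] .

lemma gnz:
  fixes f :: "'a \<Rightarrow> 'a measure \<Rightarrow> real"
  assumes "(\<lambda>(x, \<mu>). f x \<mu>) \<in> borel_measurable (L \<Otimes>\<^sub>M config_algebra L)"
    and "\<And>x \<mu>. x \<in> space L \<Longrightarrow> \<mu> \<in> configs L \<Longrightarrow> 0 \<le> f x \<mu>"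
  shows "(\<integral>\<^sup>+\<omega>. (\<integral>\<^sup>+x. ennreal (f x (\<xi> \<omega>)) \<partial>(\<xi> \<omega>)) \<partial>P) =
    (\<integral>\<^sup>+\<omega>. (\<integral>\<^sup>+x. ennreal (f x (add_point (\<xi> \<omega>) x)) * ennreal (\<kappa> x (\<xi> \<omega>)) \<partial>L) \<partial>P)"
  using gibbs[unfolded gibbs_process_def, THEN conjunct2, rule_format, of "\<lambda>(x, \<mu>). f x \<mu>"] assms
  by (auto simp: space_pair_measure space_config_algebra)

text \<open>
  The Gibbs equation for \<open>F(\<mu>) 1{x \<in> D, \<mu>(D) = n + 1}\<close> gives
  \<open>(n + 1) E[F(\<xi>); \<xi>(D) = n + 1] \<le> (\<alpha>\<lambda>)(D) E[F(\<xi>); \<xi>(D) = n]\<close>; iterate and sum over \<open>n\<close>.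
\<close>

lemma nn_integral_le_exp_void:
  fixes F :: "'a measure \<Rightarrow> real"
  assumes D: "D \<in> sets L" "emeasure L D < \<infinity>"
    and F [measurable]: "F \<in> borel_measurable (config_algebra L)"
    and F_nonneg: "\<And>\<mu>. \<mu> \<in> configs L \<Longrightarrow> 0 \<le> F \<mu>"
    and F_add: "\<And>\<mu> x. \<mu> \<in> configs L \<Longrightarrow> x \<in> D \<Longrightarrow> F (add_point \<mu> x) = F \<mu>"
  shows "(\<integral>\<^sup>+\<omega>. ennreal (F (\<xi> \<omega>)) \<partial>P) \<le>
    ennreal (exp (measure dom D)) *
      (\<integral>\<^sup>+\<omega>. ennreal (F (\<xi> \<omega>) * (if emeasure (\<xi> \<omega>) D = 0 then 1 else 0)) \<partial>P)"
proof -
  have [measurable]: "D \<in> sets L" by fact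
  have [measurable]: "(\<lambda>\<mu>. emeasure \<mu> D) \<in> borel_measurable (config_algebra L)"
    using D by (intro measurable_emeasure_config_algebra)
  define a where "a = measure dom D"
  have a: "0 \<le> a" "ennreal a = (\<integral>\<^sup>+x\<in>D. ennreal (\<alpha> x) \<partial>L)"
    using D by (auto simp: a_def emeasure_dom emeasure_dom_finite[symmetric])
  define I where "I n \<mu> = (if emeasure \<mu> D = of_nat n then 1 else 0 :: real)" for n and \<mu> :: "'a measure"
  have [measurable]: "I n \<in> borel_measurable (config_algebra L)" for n
    unfolding I_def by measurable
  define e where "e n = (\<integral>\<^sup>+\<omega>. ennreal (F (\<xi> \<omega>) * I n (\<xi> \<omega>)) \<partial>P)" for n
  have step: "of_nat (Suc n) * e (Suc n) \<le> ennreal a * e n" for n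
  proof -
    \<comment> \<open>Integrating \<open>f\<close> against \<xi> multiplies by the mass of
      \<open>D\<close>, which is n + 1 on the event, and so produces the factor on the left.\<close>
    define f where "f x \<mu> = F \<mu> * I (Suc n) \<mu> * indicator D x" for x and \<mu> :: "'a measure"
    have "of_nat (Suc n) * e (Suc n) =
        (\<integral>\<^sup>+\<omega>. of_nat (Suc n) * ennreal (F (\<xi> \<omega>) * I (Suc n) (\<xi> \<omega>)) \<partial>P)"
      unfolding e_def by (rule nn_integral_cmult[symmetric]) measurable
    also have "\<dots> = (\<integral>\<^sup>+\<omega>. (\<integral>\<^sup>+x. ennreal (f x (\<xi> \<omega>)) \<partial>(\<xi> \<omega>)) \<partial>P)"
    proof (rule nn_integral_cong)
      fix \<omega> assume \<omega>: "\<omega> \<in> space P"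
      have "(\<integral>\<^sup>+x. ennreal (f x (\<xi> \<omega>)) \<partial>(\<xi> \<omega>)) =
          (\<integral>\<^sup>+x. ennreal (F (\<xi> \<omega>) * I (Suc n) (\<xi> \<omega>)) * indicator D x \<partial>(\<xi> \<omega>))"
        by (intro nn_integral_cong) (simp add: f_def indicator_def)
      also have "\<dots> = ennreal (F (\<xi> \<omega>) * I (Suc n) (\<xi> \<omega>)) * emeasure (\<xi> \<omega>) D"
        using D configs_sets[OF xi_configs[OF \<omega>]] by (simp add: nn_integral_cmult_indicator)
      also have "\<dots> = of_nat (Suc n) * ennreal (F (\<xi> \<omega>) * I (Suc n) (\<xi> \<omega>))"
        by (simp add: I_def mult.commute)
      finally show "of_nat (Suc n) * ennreal (F (\<xi> \<omega>) * I (Suc n) (\<xi> \<omega>)) =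
          (\<integral>\<^sup>+x. ennreal (f x (\<xi> \<omega>)) \<partial>(\<xi> \<omega>))" by simp
    qed
    also have "\<dots> = (\<integral>\<^sup>+\<omega>. (\<integral>\<^sup>+x. ennreal (f x (add_point (\<xi> \<omega>) x)) * ennreal (\<kappa> x (\<xi> \<omega>)) \<partial>L) \<partial>P)"
    proof (rule gnz)
      show "(\<lambda>(x, \<mu>). f x \<mu>) \<in> borel_measurable (L \<Otimes>\<^sub>M config_algebra L)"
        unfolding f_def by measurable
    qed (simp add: f_def I_def F_nonneg)
    also have "\<dots> \<le> (\<integral>\<^sup>+\<omega>. ennreal a * ennreal (F (\<xi> \<omega>) * I n (\<xi> \<omega>)) \<partial>P)"
    proof (rule nn_integral_mono)
      fix \<omega> assume \<omega>: "\<omega> \<in> space P"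
      have \<mu>: "\<xi> \<omega> \<in> configs L" using \<omega> by (rule xi_configs)
      \<comment> \<open>A new point in \<open>D\<close> raises the count by one, so the event for n
        + 1 turns into the event for n. This is the index shift of the recursion.\<close>
      have I: "I (Suc n) (add_point (\<xi> \<omega>) x) = I n (\<xi> \<omega>)" if x: "x \<in> D" for x
      proof -
        obtain k where "emeasure (\<xi> \<omega>) D = of_nat k"
          using configs_Nats[OF \<mu> D] by (auto elim: Nats_cases)
        moreover have "emeasure (add_point (\<xi> \<omega>) x) D = of_nat (Suc k)"
          using calculation x D by (simp add: emeasure_add_point configs_sets[OF \<mu>] add.commute)
        ultimately show ?thesis unfolding I_def by (simp only: of_nat_eq_iff nat.inject)
      qed
      have "(\<integral>\<^sup>+x. ennreal (f x (add_point (\<xi> \<omega>) x)) * ennreal (\<kappa> x (\<xi> \<omega>)) \<partial>L) \<le>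
          (\<integral>\<^sup>+x. ennreal (F (\<xi> \<omega>) * I n (\<xi> \<omega>)) * (ennreal (\<alpha> x) * indicator D x) \<partial>L)"
      proof (rule nn_integral_mono)
        fix x assume x: "x \<in> space L"
        have "ennreal (\<kappa> x (\<xi> \<omega>)) \<le> ennreal (\<alpha> x)"
          using kappa_le[OF x \<mu>] by (rule ennreal_leI)
        then show "ennreal (f x (add_point (\<xi> \<omega>) x)) * ennreal (\<kappa> x (\<xi> \<omega>)) \<le>
            ennreal (F (\<xi> \<omega>) * I n (\<xi> \<omega>)) * (ennreal (\<alpha> x) * indicator D x)"
          using F_add[OF \<mu>, of x] I[of x]
          by (cases "x \<in> D") (auto simp: f_def intro!: mult_left_mono)
      qed
      also have "\<dots> = ennreal (F (\<xi> \<omega>) * I n (\<xi> \<omega>)) * ennreal a"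
        unfolding a by (rule nn_integral_cmult) measurable
      finally show "(\<integral>\<^sup>+x. ennreal (f x (add_point (\<xi> \<omega>) x)) * ennreal (\<kappa> x (\<xi> \<omega>)) \<partial>L) \<le>
          ennreal a * ennreal (F (\<xi> \<omega>) * I n (\<xi> \<omega>))" by (simp add: mult.commute)
    qed
    also have "\<dots> = ennreal a * e n"
      unfolding e_def by (rule nn_integral_cmult) measurable
    finally show ?thesis .
  qed
  have e_le: "e n \<le> ennreal (a ^ n / fact n) * e 0" for n
  proof (induction n)
    case (Suc n)
    have one: "ennreal (1 / Suc n) * of_nat (Suc n) = 1"
      by (simp add: ennreal_of_nat_eq_real_of_nat ennreal_mult'[symmetric] del: of_nat_Suc)
    have n0: "0 \<le> 1 / real (Suc n)" by simp
    have "e (Suc n) = ennreal (1 / Suc n) * (of_nat (Suc n) * e (Suc n))"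
      using one by (simp add: mult.assoc[symmetric] del: of_nat_Suc)
    also have "\<dots> \<le> ennreal (1 / Suc n) * (ennreal a * (ennreal (a ^ n / fact n) * e 0))"
      using Suc step by (intro mult_left_mono order_trans[OF step]) auto
    also have "\<dots> = ennreal (1 / Suc n * (a * (a ^ n / fact n))) * e 0"
      by (simp only: ennreal_mult'[OF a(1)] ennreal_mult'[OF n0] mult.assoc)
    also have "1 / Suc n * (a * (a ^ n / fact n)) = a ^ Suc n / fact (Suc n)"
      by simp
    finally show ?case .
  qed simp
  \<comment> \<open>The count in \<open>D\<close> is a finite integer, so at each outcome exactly
    one of the events \<open>I n\<close> holds.\<close>
  have "(\<integral>\<^sup>+\<omega>. ennreal (F (\<xi> \<omega>)) \<partial>P) = (\<integral>\<^sup>+\<omega>. (\<Sum>n. ennreal (F (\<xi> \<omega>) * I n (\<xi> \<omega>))) \<partial>P)"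
  proof (rule nn_integral_cong)
    fix \<omega> assume \<omega>: "\<omega> \<in> space P"
    obtain k where k: "emeasure (\<xi> \<omega>) D = of_nat k"
      using configs_Nats[OF xi_configs[OF \<omega>] D] by (auto elim: Nats_cases)
    have "(\<Sum>n. ennreal (F (\<xi> \<omega>) * I n (\<xi> \<omega>))) = (\<Sum>n\<in>{k}. ennreal (F (\<xi> \<omega>) * I n (\<xi> \<omega>)))"
      by (rule suminf_finite) (auto simp: I_def k)
    then show "ennreal (F (\<xi> \<omega>)) = (\<Sum>n. ennreal (F (\<xi> \<omega>) * I n (\<xi> \<omega>)))"
      by (simp add: I_def k)
  qed
  also have "\<dots> = (\<Sum>n. e n)"
    unfolding e_def by (rule nn_integral_suminf) measurable
  also have "\<dots> \<le> (\<Sum>n. ennreal (a ^ n / fact n) * e 0)"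
    by (intro suminf_le e_le) auto
  also have "\<dots> = (\<Sum>n. ennreal (a ^ n / fact n)) * e 0"
    by simp
  also have "(\<Sum>n. ennreal (a ^ n / fact n)) = ennreal (exp a)"
    using a(1) summable_exp[of a] by (subst suminf_ennreal2) (auto simp: exp_def divide_inverse mult.commute)
  finally show ?thesis
    by (simp add: e_def a_def I_def)
qed

end

subsection \<open>The last point in a region\<close>

text \<open>If \<mu> puts no mass on the neighbours of x other than x, then no path via \<mu> gets
  past x. The cluster is then the restriction of \<mu> to the direct neighbours, which is
  zero.\<close>

lemma cluster_eq_null_measure:
  assumes \<mu>: "\<mu> \<in> configs L" and x: "x \<in> space L"
    and R_space: "{y \<in> space L. R x y} \<in> sets L" and single: "\<And>y. y \<in> space L \<Longrightarrow> {y} \<in> sets L"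
    and null: "emeasure \<mu> {y \<in> space L. y \<noteq> x \<and> R x y} = 0"
  shows "cluster R x \<mu> = null_measure L"
proof -
  define N where "N = {y \<in> space L. y \<noteq> x \<and> R x y}"
  have N: "N \<in> sets \<mu>"
  proof -
    have "N = {y \<in> space L. R x y} - {x}" by (auto simp: N_def)
    then show ?thesis using R_space single[OF x] by (simp add: configs_sets[OF \<mu>])
  qed
  have "z \<notin> N" if "z \<in> points \<mu>" for z
  proof
    assume "z \<in> N"
    then have "emeasure \<mu> {z} \<le> emeasure \<mu> N" by (intro emeasure_mono N) auto
    then show False using that null by (simp add: points_def N_def)
  qed
  then have pts: "z = x" if "z \<in> points \<mu>" "R x z" for z
    using that by (auto simp: N_def points_def configs_space[OF \<mu>])
  \<comment> \<open>Intermediate points of a path belong to \<mu>, and the only point of \<mu> that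
    can be related to x is x itself. A path can therefore only wait at x, when \<open>R x x\<close>
    holds, before its final step.\<close>
  have "connected_via R \<mu> x y \<longleftrightarrow> R x y" for y
  proof
    assume "connected_via R \<mu> x y"
    then obtain n and p :: "nat \<Rightarrow> 'a" where p: "p 0 = x" "p (n + 1) = y"
      "\<forall>i\<in>{1..n}. p i \<in> points \<mu>" "\<forall>i\<in>{0..n}. R (p i) (p (i + 1))"
      by (auto simp: connected_via_def)
    have "i \<le> n \<Longrightarrow> p i = x" for i
    proof (induction i)
      case (Suc i)
      then have "R x (p (i + 1))" using p(4) by (metis Suc_leD atLeastAtMost_iff le0)
      moreover have "p (i + 1) \<in> points \<mu>" using p(3) Suc by auto
      ultimately show ?case using pts by simp
    qed (simp add: p)
    then show "R x y" using p(2,4) by (metis atLeastAtMost_iff le0 order_refl)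
  next
    assume "R x y"
    then show "connected_via R \<mu> x y"
      unfolding connected_via_def
      by (intro exI[of _ 0] exI[of _ "\<lambda>i. if i = 0 then x else y"]) auto
  qed
  then have eq: "cluster R x \<mu> = restr_measure \<mu> N"
    by (simp add: cluster_def N_def configs_space[OF \<mu>])
  show ?thesis
    unfolding eq
  proof (rule measure_eqI)
    show "sets (restr_measure \<mu> N) = sets (null_measure L)"
      by (simp add: restr_measure_def configs_sets[OF \<mu>])
    fix A assume "A \<in> sets (restr_measure \<mu> N)"
    then have A: "A \<in> sets \<mu>" by (simp add: restr_measure_def)
    have "emeasure \<mu> (N \<inter> A) \<le> emeasure \<mu> N" using N by (intro emeasure_mono) auto
    then show "emeasure (restr_measure \<mu> N) A = emeasure (null_measure L) A"
      using null A N by (simp add: emeasure_restr_measure N_def)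
  qed
qed

text \<open>Replaces adjacency, which speaks of atoms, by a null set, which is measurable in the
  configuration. An atom in the set gives it mass. Conversely, if the set has mass, so does its
  intersection with some set of finite \<open>L\<close>-measure, and \<open>last_atom\<close> finds
  an atom there.\<close>

lemma not_adj_config_iff:
  fixes \<phi> :: "'a \<Rightarrow> real"
  assumes "sigma_finite_measure L"
    and \<phi>: "\<phi> \<in> borel_measurable L" "inj_on \<phi> (space L)" "\<phi> ` space L \<subseteq> {0..1}"
    and single: "\<And>y. y \<in> space L \<Longrightarrow> {y} \<in> sets L"
    and \<mu>: "\<mu> \<in> configs L" and R_space: "{z \<in> space L. R x z} \<in> sets L" and C: "C \<in> sets L"
  shows "\<not> adj_config R x (restr_measure \<mu> C) \<longleftrightarrow> emeasure \<mu> {z \<in> C. R x z} = 0"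
proof -
  interpret sigma_finite_measure L by fact
  have [simp]: "sets \<mu> = sets L" "space \<mu> = space L"
    using configs_sets[OF \<mu>] configs_space[OF \<mu>] by auto
  have "{z \<in> C. R x z} = C \<inter> {z \<in> space L. R x z}" using sets.sets_into_space[OF C] by auto
  then have CR: "{z \<in> C. R x z} \<in> sets L" using C R_space by auto
  have pts: "z \<in> points (restr_measure \<mu> C) \<longleftrightarrow> z \<in> C \<and> emeasure \<mu> {z} \<noteq> 0" for z
  proof (cases "z \<in> space L")
    case True
    have "emeasure (restr_measure \<mu> C) {z} = emeasure \<mu> (C \<inter> {z})"
      using C single[OF True] by (simp add: emeasure_restr_measure)
    moreover have "space (restr_measure \<mu> C) = space L" by (simp add: restr_measure_def)
    ultimately show ?thesis
      using True by (cases "z \<in> C") (auto simp: points_def zero_less_iff_neq_zero)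
  next
    case False
    then show ?thesis
      using sets.sets_into_space[OF C] by (auto simp: points_def restr_measure_def)
  qed
  show ?thesis
  proof
    assume "emeasure \<mu> {z \<in> C. R x z} = 0"
    moreover have "emeasure \<mu> {z} \<le> emeasure \<mu> {z \<in> C. R x z}" if "z \<in> C" "R x z" for z
      using that CR by (intro emeasure_mono) auto
    ultimately show "\<not> adj_config R x (restr_measure \<mu> C)"
      by (auto simp: adj_config_def pts)
  next
    assume nadj: "\<not> adj_config R x (restr_measure \<mu> C)"
    obtain E :: "nat \<Rightarrow> 'a set" where E: "range E \<subseteq> sets L" "(\<Union>i. E i) = space L"
      "\<And>i. emeasure L (E i) \<noteq> \<infinity>"
      using sigma_finite by metis
    have "emeasure \<mu> (E i \<inter> {z \<in> C. R x z}) = 0" for i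
    proof (rule ccontr)
      assume pos: "emeasure \<mu> (E i \<inter> {z \<in> C. R x z}) \<noteq> 0"
      have s: "E i \<inter> {z \<in> C. R x z} \<in> sets L" using E CR by auto
      have "emeasure L (E i \<inter> {z \<in> C. R x z}) \<le> emeasure L (E i)"
        using E by (intro emeasure_mono) auto
      also have "\<dots> < \<infinity>" using E(3)[of i] by (simp add: less_top)
      finally obtain z where "z \<in> E i \<inter> {z \<in> C. R x z}" "emeasure \<mu> {z} \<noteq> 0"
        using last_atom[OF \<phi> \<mu> s _ pos] by metis
      then show False using nadj by (auto simp: adj_config_def pts)
    qed
    then have "emeasure \<mu> (\<Union>i. E i \<inter> {z \<in> C. R x z}) = 0"
      using E CR by (intro emeasure_UN_eq_0) auto
    also have "(\<Union>i. E i \<inter> {z \<in> C. R x z}) = {z \<in> C. R x z}"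
      using E(2) sets.sets_into_space[OF C] by auto
    finally show "emeasure \<mu> {z \<in> C. R x z} = 0" .
  qed
qed

section \<open>The region, its order and the intensity in the exponent\<close>

locale cluster_gibbs_region = dominated_gibbs P L \<kappa> \<alpha> \<xi>
  for P :: "'w measure" and L :: "'a measure" and \<kappa> \<alpha> \<xi> +
  fixes R :: "'a \<Rightarrow> 'a \<Rightarrow> bool" and B :: "'a set" and \<phi> :: "'a \<Rightarrow> real"
  assumes phi: "\<phi> \<in> borel_measurable L" "inj_on \<phi> (space L)" "\<phi> ` space L \<subseteq> {0..1}"
    and diffuse: "\<And>x. x \<in> space L \<Longrightarrow> emeasure L {x} = 0"
    and R_sym: "\<And>x y. x \<in> space L \<Longrightarrow> y \<in> space L \<Longrightarrow> R x y \<Longrightarrow> R y x"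
    and R_measurable: "{(x, y) \<in> space L \<times> space L. R x y} \<in> sets (L \<Otimes>\<^sub>M L)"
    and kappa_cluster: "\<And>x \<mu>. x \<in> space L \<Longrightarrow> \<mu> \<in> configs L \<Longrightarrow> \<kappa> x \<mu> = \<kappa> x (cluster R x \<mu>)"
    and B: "B \<in> sets L" "emeasure L B < \<infinity>"
begin

lemma phi_measurable [measurable]: "\<phi> \<in> borel_measurable L"
  by (rule phi)

lemma B_measurable [measurable]: "B \<in> sets L"
  by (rule B)

lemma B_space: "x \<in> B \<Longrightarrow> x \<in> space L"
  using sets.sets_into_space[OF B(1)] by auto

lemma phi_eq_iff: "x \<in> space L \<Longrightarrow> y \<in> space L \<Longrightarrow> \<phi> x = \<phi> y \<longleftrightarrow> x = y"
  using inj_onD[OF phi(2)] by auto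

lemma R_pred [measurable]: "Measurable.pred (L \<Otimes>\<^sub>M L) (\<lambda>p. R (fst p) (snd p))"
proof -
  have "{p \<in> space (L \<Otimes>\<^sub>M L). R (fst p) (snd p)} = {(x, y) \<in> space L \<times> space L. R x y}"
    by (auto simp: space_pair_measure)
  then show ?thesis using R_measurable by (simp add: pred_def)
qed

lemma R_pred' [measurable (raw)]:
  assumes "f \<in> M \<rightarrow>\<^sub>M L" "g \<in> M \<rightarrow>\<^sub>M L"
  shows "Measurable.pred M (\<lambda>w. R (f w) (g w))"
  using measurable_compose[OF measurable_Pair[OF assms] R_pred] by simp

lemma singleton_sets: "x \<in> space L \<Longrightarrow> {x} \<in> sets L"
proof -
  assume x: "x \<in> space L"
  have "{x} = {y \<in> space L. \<phi> y = \<phi> x}" using x phi_eq_iff by auto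
  also have "\<dots> \<in> sets L" by measurable
  finally show ?thesis .
qed

definition nb_mass :: "'a \<Rightarrow> real" where
  "nb_mass x = measure dom (nbhd L R x \<inter> B)"

text \<open>The measurable form of "x has no neighbour in the configuration outside B";
  \<open>free_part_eq\<close> links it to the wording with points.\<close>

definition isolated :: "'a measure \<Rightarrow> 'a \<Rightarrow> bool" where
  "isolated \<mu> x \<longleftrightarrow> emeasure \<mu> {z \<in> space L - B. R x z} = 0"

text \<open>The integrand of the exponent in the theorem, with the indicator of the free part
  written through \<open>isolated\<close>. It sees the configuration only outside \<open>B\<close>,
  hence is unchanged when points of \<open>B\<close> are added.\<close>

definition intens :: "'a measure \<Rightarrow> 'a \<Rightarrow> real" where
  "intens \<mu> x = indicator B x * (if isolated \<mu> x then 1 else 0) * exp (- nb_mass x)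
     * \<kappa> x (null_measure L)"

definition intens_measure :: "'a measure \<Rightarrow> 'a measure" where
  "intens_measure \<mu> = density L (\<lambda>x. ennreal (intens \<mu> x))"

definition tail_mass :: "'a measure \<Rightarrow> 'a \<Rightarrow> real" where
  "tail_mass \<mu> x = measure (intens_measure \<mu>) {y \<in> space L. \<phi> x < \<phi> y}"

definition total_mass :: "'a measure \<Rightarrow> real" where
  "total_mass \<mu> = measure (intens_measure \<mu>) (space L)"

definition empty_after :: "'a measure \<Rightarrow> 'a \<Rightarrow> bool" where
  "empty_after \<mu> x \<longleftrightarrow> emeasure \<mu> {y \<in> B. \<phi> x < \<phi> y} = 0"

section \<open>Measurability in the point and the configuration, and mass bounds\<close>

lemma section_measurable:
  assumes "Measurable.pred (L \<Otimes>\<^sub>M L) (\<lambda>p. T (fst p) (snd p))"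
  shows "(\<lambda>p. emeasure (snd p) {z \<in> space L. T (fst p) z}) \<in> borel_measurable (L \<Otimes>\<^sub>M config_algebra L)"
proof -
  have "{p \<in> space (L \<Otimes>\<^sub>M L). T (fst p) (snd p)} \<in> sets (L \<Otimes>\<^sub>M L)"
    using assms by (simp add: pred_def)
  from measurable_emeasure_section[OF L.sigma_finite_measure_axioms this]
  show ?thesis
  proof (rule measurable_cong[THEN iffD1, rotated])
    fix p assume "p \<in> space (L \<Otimes>\<^sub>M config_algebra L)"
    then have "Pair (fst p) -` {p \<in> space (L \<Otimes>\<^sub>M L). T (fst p) (snd p)} = {z \<in> space L. T (fst p) z}"
      by (auto simp: space_pair_measure)
    then show "(case p of (x, \<mu>) \<Rightarrow>
        emeasure \<mu> (Pair x -` {p \<in> space (L \<Otimes>\<^sub>M L). T (fst p) (snd p)})) =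
      emeasure (snd p) {z \<in> space L. T (fst p) z}"
      by (simp add: case_prod_unfold)
  qed
qed

lemma section_in_B_measurable:
  assumes "Measurable.pred (L \<Otimes>\<^sub>M L) (\<lambda>p. T (fst p) (snd p))"
  shows "(\<lambda>p. emeasure (snd p) {z \<in> B. T (fst p) z}) \<in> borel_measurable (L \<Otimes>\<^sub>M config_algebra L)"
proof -
  have [measurable]: "Measurable.pred (L \<Otimes>\<^sub>M L) (\<lambda>p. T (fst p) (snd p))" by fact
  have "{z \<in> B. T x z} = {z \<in> space L. z \<in> B \<and> T x z}" for x
    using B_space by auto
  moreover have "Measurable.pred (L \<Otimes>\<^sub>M L) (\<lambda>p. snd p \<in> B \<and> T (fst p) (snd p))" by measurable
  ultimately show ?thesis
    using section_measurable[of "\<lambda>x z. z \<in> B \<and> T x z"] by simp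
qed

lemma isolated_measurable [measurable]:
  "Measurable.pred (L \<Otimes>\<^sub>M config_algebra L) (\<lambda>p. isolated (snd p) (fst p))"
proof -
  have "{z \<in> space L - B. R x z} = {z \<in> space L. z \<notin> B \<and> R x z}" for x by auto
  moreover have "Measurable.pred (L \<Otimes>\<^sub>M L) (\<lambda>p. snd p \<notin> B \<and> R (fst p) (snd p))" by measurable
  note section_measurable[of "\<lambda>x z. z \<notin> B \<and> R x z", OF this]
  ultimately show ?thesis unfolding isolated_def by simp
qed

lemma empty_after_measurable [measurable]:
  "Measurable.pred (L \<Otimes>\<^sub>M config_algebra L) (\<lambda>p. empty_after (snd p) (fst p))"
proof -
  have "Measurable.pred (L \<Otimes>\<^sub>M L) (\<lambda>p. \<phi> (fst p) < \<phi> (snd p))" by measurable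
  note section_in_B_measurable[of "\<lambda>x z. \<phi> x < \<phi> z", OF this, measurable]
  show ?thesis unfolding empty_after_def by measurable
qed

lemma nbhd_sets: "x \<in> space L \<Longrightarrow> nbhd L R x \<in> sets L"
proof -
  assume x: "x \<in> space L"
  have "nbhd L R x = {y \<in> space L. R y x} - {x}" by (auto simp: nbhd_def)
  also have "\<dots> \<in> sets L" using x singleton_sets by measurable
  finally show ?thesis .
qed

lemma nb_mass_measurable [measurable]: "nb_mass \<in> borel_measurable L"
proof -
  \<comment> \<open>The condition \<open>\<phi> y \<noteq> \<phi> x\<close> stands for y \<noteq> x:
    by injectivity the two agree on the space, and the former is visibly measurable in the
    pair.\<close>
  have "(\<lambda>x. \<integral>\<^sup>+y. ennreal (\<alpha> y) * (if \<phi> y \<noteq> \<phi> x \<and> R y x \<and> y \<in> B then 1 else 0) \<partial>L)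
      \<in> borel_measurable L" by measurable
  then have "(\<lambda>x. enn2real (\<integral>\<^sup>+y. ennreal (\<alpha> y) * (if \<phi> y \<noteq> \<phi> x \<and> R y x \<and> y \<in> B then 1 else 0) \<partial>L))
      \<in> borel_measurable L" by measurable
  also have "?this \<longleftrightarrow> ?thesis"
  proof (rule measurable_cong)
    fix x assume x: "x \<in> space L"
    have "(\<integral>\<^sup>+y. ennreal (\<alpha> y) * (if \<phi> y \<noteq> \<phi> x \<and> R y x \<and> y \<in> B then 1 else 0) \<partial>L) =
        emeasure dom (nbhd L R x \<inter> B)"
      using x nbhd_sets[OF x] phi_eq_iff
      by (subst emeasure_dom) (auto intro!: nn_integral_cong simp: indicator_def nbhd_def)
    then show "enn2real (\<integral>\<^sup>+y. ennreal (\<alpha> y) * (if \<phi> y \<noteq> \<phi> x \<and> R y x \<and> y \<in> B then 1 else 0) \<partial>L) =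
        nb_mass x"
      by (simp add: nb_mass_def measure_def)
  qed
  finally show ?thesis .
qed

lemma kappa_null_measurable [measurable]: "(\<lambda>x. \<kappa> x (null_measure L)) \<in> borel_measurable L"
proof -
  have "null_measure L \<in> space (config_algebra L)"
    by (simp add: space_config_algebra null_measure_configs)
  then have "(\<lambda>x. (x, null_measure L)) \<in> L \<rightarrow>\<^sub>M L \<Otimes>\<^sub>M config_algebra L" by measurable
  from measurable_compose[OF this kappa_measurable] show ?thesis by simp
qed

lemma intens_measurable [measurable]:
  "(\<lambda>p. intens (snd p) (fst p)) \<in> borel_measurable (L \<Otimes>\<^sub>M config_algebra L)"
  unfolding intens_def by measurable

lemma intens_measurable' [measurable (raw)]:
  assumes "f \<in> M \<rightarrow>\<^sub>M L" "g \<in> M \<rightarrow>\<^sub>M config_algebra L"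
  shows "(\<lambda>w. intens (g w) (f w)) \<in> borel_measurable M"
  using measurable_compose[OF measurable_Pair[OF assms] intens_measurable] by simp

lemma intens_measurable_fst: "\<mu> \<in> configs L \<Longrightarrow> intens \<mu> \<in> borel_measurable L"
  using intens_measurable'[of "\<lambda>x. x" L "\<lambda>_. \<mu>"] by (simp add: space_config_algebra)

lemma intens_nonneg: "x \<in> space L \<Longrightarrow> 0 \<le> intens \<mu> x"
  using kappa_nonneg[OF _ null_measure_configs] by (simp add: intens_def)

lemma intens_le: "x \<in> space L \<Longrightarrow> intens \<mu> x \<le> indicator B x * \<alpha> x"
proof -
  assume x: "x \<in> space L"
  have "exp (- nb_mass x) * \<kappa> x (null_measure L) \<le> 1 * \<alpha> x"
    using x kappa_nonneg[OF x null_measure_configs] kappa_le[OF x null_measure_configs] alpha_nonneg[OF x]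
    by (intro mult_mono) (auto simp: nb_mass_def)
  then show ?thesis
    using alpha_nonneg[OF x] by (auto simp: intens_def indicator_def)
qed

lemma sets_intens_measure [simp]: "sets (intens_measure \<mu>) = sets L" "space (intens_measure \<mu>) = space L"
  by (simp_all add: intens_measure_def)

lemma emeasure_intens_measure:
  "\<mu> \<in> configs L \<Longrightarrow> A \<in> sets L \<Longrightarrow>
    emeasure (intens_measure \<mu>) A = (\<integral>\<^sup>+x. ennreal (intens \<mu> x) * indicator A x \<partial>L)"
  unfolding intens_measure_def using intens_measurable_fst[of \<mu>] by (simp add: emeasure_density)

text \<open>The bound is uniform in the configuration, since the exponential factor is at most 1 and
  \<kappa>(x, 0) \<le> \<alpha>(x). It later guarantees that the term to be cancelled is
  finite.\<close>

lemma emeasure_intens_measure_le: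
  assumes "\<mu> \<in> configs L" "A \<in> sets L"
  shows "emeasure (intens_measure \<mu>) A \<le> ennreal (measure dom B)"
proof -
  have "emeasure (intens_measure \<mu>) A \<le> (\<integral>\<^sup>+x\<in>B. ennreal (\<alpha> x) \<partial>L)"
    unfolding emeasure_intens_measure[OF assms]
  proof (rule nn_integral_mono)
    fix x assume x: "x \<in> space L"
    have "ennreal (intens \<mu> x) \<le> ennreal (indicator B x * \<alpha> x)"
      using intens_le[OF x] by (rule ennreal_leI)
    then show "ennreal (intens \<mu> x) * indicator A x \<le> ennreal (\<alpha> x) * indicator B x"
      by (auto simp: indicator_def split: if_splits)
  qed
  then show ?thesis
    using B by (simp add: emeasure_dom[symmetric] emeasure_dom_finite)
qed

lemma finite_intens_measure: "\<mu> \<in> configs L \<Longrightarrow> finite_measure (intens_measure \<mu>)"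
  using emeasure_intens_measure_le[of \<mu> "space L"]
  by (intro finite_measureI) (auto simp: top_unique)

lemma measure_intens_measure_le:
  assumes "\<mu> \<in> configs L" "A \<in> sets L"
  shows "measure (intens_measure \<mu>) A \<le> measure dom B"
  using emeasure_intens_measure_le[OF assms] finite_measure.emeasure_eq_measure[OF finite_intens_measure[OF assms(1)]]
  by simp

lemma tail_mass_measurable [measurable]:
  "(\<lambda>p. tail_mass (snd p) (fst p)) \<in> borel_measurable (L \<Otimes>\<^sub>M config_algebra L)"
proof -
  have "(\<lambda>p. \<integral>\<^sup>+y. ennreal (intens (snd p) y) * (if \<phi> (fst p) < \<phi> y then 1 else 0) \<partial>L)
      \<in> borel_measurable (L \<Otimes>\<^sub>M config_algebra L)" by measurable
  then have "(\<lambda>p. enn2real (\<integral>\<^sup>+y. ennreal (intens (snd p) y) * (if \<phi> (fst p) < \<phi> y then 1 else 0) \<partial>L))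
      \<in> borel_measurable (L \<Otimes>\<^sub>M config_algebra L)" by measurable
  also have "?this \<longleftrightarrow> ?thesis"
  proof (rule measurable_cong)
    fix p assume "p \<in> space (L \<Otimes>\<^sub>M config_algebra L)"
    then have \<mu>: "snd p \<in> configs L" by (auto simp: space_pair_measure space_config_algebra)
    have "(\<integral>\<^sup>+y. ennreal (intens (snd p) y) * (if \<phi> (fst p) < \<phi> y then 1 else 0) \<partial>L) =
        emeasure (intens_measure (snd p)) {y \<in> space L. \<phi> (fst p) < \<phi> y}"
      by (subst emeasure_intens_measure[OF \<mu>]) (auto intro!: nn_integral_cong simp: indicator_def)
    then show "enn2real (\<integral>\<^sup>+y. ennreal (intens (snd p) y) * (if \<phi> (fst p) < \<phi> y then 1 else 0) \<partial>L) =
        tail_mass (snd p) (fst p)"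
      by (simp add: tail_mass_def measure_def)
  qed
  finally show ?thesis .
qed

lemma total_mass_measurable [measurable]: "total_mass \<in> borel_measurable (config_algebra L)"
proof -
  have "(\<lambda>\<mu>. enn2real (\<integral>\<^sup>+y. ennreal (intens \<mu> y) \<partial>L)) \<in> borel_measurable (config_algebra L)"
    by measurable
  also have "?this \<longleftrightarrow> ?thesis"
    by (intro measurable_cong)
      (auto simp: total_mass_def measure_def emeasure_intens_measure space_config_algebra
        intro!: nn_integral_cong arg_cong[where f=enn2real])
  finally show ?thesis .
qed

text \<open>The exponential inequality for the intensity restricted to \<open>U\<close>. As
  \<open>U\<close> is closed upwards, the restriction does not change the mass above a point of
  \<open>U\<close>, so the weight is the same \<open>tail_mass\<close> for every \<open>U\<close>.
  It serves for the whole space, when the region is empty, and for the part after the last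
  point.\<close>

lemma exp_mass_le_nn_integral:
  assumes \<mu>: "\<mu> \<in> configs L" and U: "U \<in> sets L"
    and up: "\<And>x y. x \<in> U \<Longrightarrow> y \<in> space L \<Longrightarrow> \<phi> x < \<phi> y \<Longrightarrow> y \<in> U"
  shows "ennreal (exp (measure (intens_measure \<mu>) U) - 1) \<le>
    (\<integral>\<^sup>+x. ennreal (exp (tail_mass \<mu> x)) * (ennreal (intens \<mu> x) * indicator U x) \<partial>L)"
proof -
  have [measurable]: "intens \<mu> \<in> borel_measurable L" using \<mu> by (rule intens_measurable_fst)
  have [measurable]: "U \<in> sets L" by fact
  define N where "N = density L (\<lambda>x. ennreal (intens \<mu> x) * indicator U x)"
  have N_eq: "emeasure N A = emeasure (intens_measure \<mu>) (A \<inter> U)" if "A \<in> sets L" for A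
  proof -
    have "emeasure N A = (\<integral>\<^sup>+x. ennreal (intens \<mu> x) * indicator U x * indicator A x \<partial>L)"
      unfolding N_def using that by (intro emeasure_density) measurable
    also have "\<dots> = (\<integral>\<^sup>+x. ennreal (intens \<mu> x) * indicator (A \<inter> U) x \<partial>L)"
      by (intro nn_integral_cong) (auto simp: indicator_def)
    finally show ?thesis using \<mu> that by (simp add: emeasure_intens_measure)
  qed
  have sN [simp]: "sets N = sets L" "space N = space L" by (simp_all add: N_def)
  have fin: "finite_measure N"
    using N_eq[of "space L"] emeasure_intens_measure_le[OF \<mu>, of "space L \<inter> U"]
    by (intro finite_measureI) (auto simp: top_unique)
  have "ennreal (exp (measure N (space N)) - 1) \<le>
      (\<integral>\<^sup>+x. ennreal (exp (measure N {y \<in> space N. \<phi> x < \<phi> y})) \<partial>N)"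
  proof (rule exp_minus_one_le_nn_integral[OF fin])
    show "\<phi> \<in> borel_measurable N" by (simp add: N_def)
    fix t
    \<comment> \<open>A level set of \<phi> is empty or a singleton, hence null by diffuseness; the
      density carries this over to \<open>N\<close>.\<close>
    have "emeasure L {y \<in> space L. \<phi> y = t} = 0"
    proof (cases "\<exists>x\<in>space L. \<phi> x = t")
      case True
      then obtain x where x: "x \<in> space L" "\<phi> x = t" by auto
      have "{y \<in> space L. \<phi> y = t} = {x}" using x phi_eq_iff by auto
      then show ?thesis using diffuse[OF x(1)] by simp
    next
      case False
      then have "{y \<in> space L. \<phi> y = t} = {}" by auto
      then show ?thesis by (simp only: emeasure_empty)
    qed
    then have "{y \<in> space L. \<phi> y = t} \<in> null_sets L" by (auto simp: null_sets_def)
    then have "AE y in L. \<phi> y \<noteq> t" by (rule AE_I') auto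
    then have "AE y in N. \<phi> y \<noteq> t" unfolding N_def by (subst AE_density) auto
    then show "emeasure N {y \<in> space N. \<phi> y = t} = 0"
      by (subst (asm) AE_iff_measurable[OF _ refl]) auto
  qed
  also have "\<dots> = (\<integral>\<^sup>+x. ennreal (intens \<mu> x) * indicator U x *
      ennreal (exp (measure N {y \<in> space N. \<phi> x < \<phi> y})) \<partial>L)"
    unfolding N_def
  proof (rule nn_integral_density)
    interpret N: finite_measure N by fact
    have "(\<lambda>t. - measure N {y \<in> space N. t < \<phi> y}) \<in> borel_measurable borel"
      by (intro borel_measurable_mono monoI) (auto intro!: N.finite_measure_mono)
    then have "(\<lambda>t. measure N {y \<in> space N. t < \<phi> y}) \<in> borel_measurable borel" by simp
    from measurable_compose[OF phi_measurable this]
    show "(\<lambda>x. ennreal (exp (measure (density L (\<lambda>x. ennreal (intens \<mu> x) * indicator U x))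
        {y \<in> space (density L (\<lambda>x. ennreal (intens \<mu> x) * indicator U x)). \<phi> x < \<phi> y})))
      \<in> borel_measurable L" unfolding N_def[symmetric] by measurable
  qed measurable
  also have "\<dots> = (\<integral>\<^sup>+x. ennreal (exp (tail_mass \<mu> x)) * (ennreal (intens \<mu> x) * indicator U x) \<partial>L)"
  proof (rule nn_integral_cong)
    fix x assume x: "x \<in> space L"
    have "measure N {y \<in> space N. \<phi> x < \<phi> y} = tail_mass \<mu> x" if "x \<in> U"
    proof -
      have "{y \<in> space L. \<phi> x < \<phi> y} \<inter> U = {y \<in> space L. \<phi> x < \<phi> y}" using up that by auto
      then show ?thesis using N_eq[of "{y \<in> space L. \<phi> x < \<phi> y}"] by (simp add: measure_def tail_mass_def)
    qed
    then show "ennreal (intens \<mu> x) * indicator U x * ennreal (exp (measure N {y \<in> space N. \<phi> x < \<phi> y})) =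
        ennreal (exp (tail_mass \<mu> x)) * (ennreal (intens \<mu> x) * indicator U x)"
      by (cases "x \<in> U") (auto simp: mult.commute)
  qed
  also have "measure N (space N) = measure (intens_measure \<mu>) U"
    using N_eq[of "space L"] sets.Int_space_eq1[OF U] by (simp add: measure_def)
  finally show ?thesis .
qed

text \<open>The part of the neighbourhood in \<open>B\<close> that must be emptied once nothing lies
  after x. Leaving out the later points keeps \<open>empty_after\<close> unchanged when points of
  this set are added. Including x itself ensures that an empty set leaves no mass at x, so that an
  added point at x is simple.\<close>

definition nearby :: "'a \<Rightarrow> 'a set" where
  "nearby x = {y \<in> B. (y = x \<or> R x y) \<and> \<not> \<phi> x < \<phi> y}"

lemma nearby_sets: "x \<in> space L \<Longrightarrow> nearby x \<in> sets L"
proof -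
  assume x: "x \<in> space L"
  have "nearby x = {y \<in> space L. y \<in> B \<and> (\<phi> y = \<phi> x \<or> R x y) \<and> \<not> \<phi> x < \<phi> y}"
    using x B_space phi_eq_iff by (auto simp: nearby_def)
  also have "\<dots> \<in> sets L" using x by measurable
  finally show ?thesis .
qed

lemma nearby_finite: "emeasure L (nearby x) < \<infinity>"
proof -
  have "emeasure L (nearby x) \<le> emeasure L B"
    by (intro emeasure_mono) (auto simp: nearby_def)
  then show ?thesis using B(2) by simp
qed

text \<open>The point x adds nothing because \<lambda>, and with it \<alpha>\<lambda>, has no mass
  there. Symmetry of R reconciles \<open>R x y\<close> in \<open>nearby\<close> with
  \<open>R y x\<close> in \<open>nbhd\<close>.\<close>

lemma measure_nearby_le: "x \<in> space L \<Longrightarrow> measure dom (nearby x) \<le> nb_mass x"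
proof -
  assume x: "x \<in> space L"
  have fin: "emeasure dom (nbhd L R x \<inter> B) < \<infinity>"
  proof -
    have "emeasure L (nbhd L R x \<inter> B) \<le> emeasure L B" by (intro emeasure_mono) auto
    then show ?thesis
      using B(2) nbhd_sets[OF x] by (subst emeasure_dom_finite) auto
  qed
  have "{x} \<in> null_sets L" using diffuse[OF x] singleton_sets[OF x] by auto
  then have "AE y in L. y \<noteq> x" by (auto dest: AE_not_in)
  then have "AE y in L. y \<in> {x} \<longrightarrow> ennreal (\<alpha> y) = 0" by (rule eventually_mono) simp
  then have "{x} \<in> null_sets dom"
    unfolding dom_def using singleton_sets[OF x] by (subst null_sets_density_iff) auto
  then have "emeasure dom {x} = 0" by auto
  have "{x} \<union> (nbhd L R x \<inter> B) \<in> sets dom"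
    using nbhd_sets[OF x] singleton_sets[OF x] by (intro sets.Un sets.Int) auto
  then have "emeasure dom (nearby x) \<le> emeasure dom ({x} \<union> (nbhd L R x \<inter> B))"
    using x B_space R_sym by (intro emeasure_mono) (auto simp: nearby_def nbhd_def)
  also have "\<dots> \<le> emeasure dom {x} + emeasure dom (nbhd L R x \<inter> B)"
    using nbhd_sets[OF x] singleton_sets[OF x] by (intro emeasure_subadditive) auto
  finally show ?thesis
    using \<open>emeasure dom {x} = 0\<close> fin unfolding nb_mass_def measure_def by (intro enn2real_mono) auto
qed

section \<open>Invariance under points added in the region, and the Gibbs equation for the last
  point\<close>

lemma isolated_add_point:
  assumes "\<mu> \<in> configs L" "y \<in> B" "x \<in> space L"
  shows "isolated (add_point \<mu> y) x \<longleftrightarrow> isolated \<mu> x"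
proof -
  have "{z \<in> space L - B. R x z} = {z \<in> space L. z \<notin> B \<and> R x z}" by auto
  also have "\<dots> \<in> sets L" using assms(3) by measurable
  finally show ?thesis
    using assms by (simp add: isolated_def emeasure_add_point configs_sets)
qed

lemma intens_add_point:
  assumes "\<mu> \<in> configs L" "y \<in> B"
  shows "intens (add_point \<mu> y) x = intens \<mu> x"
proof (cases "x \<in> B")
  case True
  then show ?thesis using isolated_add_point[OF assms B_space[OF True]] by (simp add: intens_def)
qed (simp add: intens_def)

lemma intens_measure_add_point:
  "\<mu> \<in> configs L \<Longrightarrow> y \<in> B \<Longrightarrow> intens_measure (add_point \<mu> y) = intens_measure \<mu>"
  by (simp add: intens_measure_def intens_add_point)

lemma tail_mass_add_point:
  "\<mu> \<in> configs L \<Longrightarrow> y \<in> B \<Longrightarrow> tail_mass (add_point \<mu> y) x = tail_mass \<mu> x"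
  by (simp add: tail_mass_def intens_measure_add_point)

lemma empty_after_sets: "{z \<in> B. \<phi> x < \<phi> z} \<in> sets L"
proof -
  have "{z \<in> B. \<phi> x < \<phi> z} = {z \<in> space L. z \<in> B \<and> \<phi> x < \<phi> z}" using B_space by auto
  also have "\<dots> \<in> sets L" by measurable
  finally show ?thesis .
qed

lemma empty_after_add_point:
  assumes "\<mu> \<in> configs L" "\<not> \<phi> x < \<phi> y"
  shows "empty_after (add_point \<mu> y) x \<longleftrightarrow> empty_after \<mu> x"
  using assms empty_after_sets[of x] by (simp add: empty_after_def emeasure_add_point configs_sets)

text \<open>Every neighbour of x other than x lies outside \<open>B\<close>, in \<open>B\<close>
  after x, or in \<open>nearby x\<close>. All three sets are null under the hypotheses, so the
  cluster of x is zero and the cluster property of \<kappa> applies.\<close>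

lemma kappa_eq_kappa_null:
  assumes x: "x \<in> space L" and \<mu>: "\<mu> \<in> configs L"
    and "isolated \<mu> x" "empty_after \<mu> x" "emeasure \<mu> (nearby x) = 0"
  shows "\<kappa> x \<mu> = \<kappa> x (null_measure L)"
proof -
  have [simp]: "sets \<mu> = sets L" using \<mu> by (rule configs_sets)
  define A where "A = {z \<in> space L - B. R x z}"
  have "A = {z \<in> space L. z \<notin> B \<and> R x z}" by (auto simp: A_def)
  also have "\<dots> \<in> sets L" using x by measurable
  finally have A: "A \<in> sets L" .
  have "emeasure \<mu> {y \<in> space L. y \<noteq> x \<and> R x y} \<le>
      emeasure \<mu> (A \<union> ({z \<in> B. \<phi> x < \<phi> z} \<union> nearby x))"
    using A empty_after_sets nearby_sets[OF x]
    by (intro emeasure_mono) (auto simp: A_def nearby_def)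
  also have "\<dots> \<le> emeasure \<mu> A + (emeasure \<mu> {z \<in> B. \<phi> x < \<phi> z} + emeasure \<mu> (nearby x))"
    using A empty_after_sets nearby_sets[OF x]
    by (intro order_trans[OF emeasure_subadditive] add_left_mono emeasure_subadditive) auto
  also have "\<dots> = 0" using assms by (simp add: isolated_def empty_after_def A_def)
  finally have "emeasure \<mu> {y \<in> space L. y \<noteq> x \<and> R x y} = 0" by simp
  moreover have "{y \<in> space L. R x y} \<in> sets L" using x by measurable
  ultimately have "cluster R x \<mu> = null_measure L"
    using cluster_eq_null_measure[OF \<mu> x] singleton_sets by blast
  then show ?thesis using kappa_cluster[OF x \<mu>] by simp
qed

text \<open>
  Keeping only those last points \<open>x\<close> whose neighbourhood in \<open>B\<close> carries no other point of \<open>\<xi>\<close>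
  makes the Papangelou intensity equal to \<open>\<kappa>(x, 0)\<close>; the emptiness of that neighbourhood costs
  at most the factor \<open>exp (- nb_mass x)\<close>.
\<close>

lemma nn_integral_last_point_ge:
  fixes G :: "'a \<Rightarrow> 'a measure \<Rightarrow> real"
  assumes G: "(\<lambda>(x, \<mu>). G x \<mu>) \<in> borel_measurable (L \<Otimes>\<^sub>M config_algebra L)"
    and G_nonneg: "\<And>x \<mu>. x \<in> space L \<Longrightarrow> \<mu> \<in> configs L \<Longrightarrow> 0 \<le> G x \<mu>"
    and G_add: "\<And>x \<mu> y. x \<in> space L \<Longrightarrow> \<mu> \<in> configs L \<Longrightarrow> y \<in> B \<Longrightarrow> G x (add_point \<mu> y) = G x \<mu>"
  shows "(\<integral>\<^sup>+\<omega>. (\<integral>\<^sup>+x. ennreal (G x (\<xi> \<omega>) * (if empty_after (\<xi> \<omega>) x then 1 else 0) * intens (\<xi> \<omega>) x) \<partial>L) \<partial>P)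
    \<le> (\<integral>\<^sup>+\<omega>. (\<integral>\<^sup>+x. ennreal (G x (\<xi> \<omega>) * indicator B x * (if empty_after (\<xi> \<omega>) x then 1 else 0)
        * (if emeasure (\<xi> \<omega>) {y \<in> B. \<phi> y = \<phi> x} = 1 then 1 else 0)) \<partial>(\<xi> \<omega>)) \<partial>P)"
proof -
  interpret LP: pair_sigma_finite L P ..
  have Gm: "(\<lambda>p. G (fst p) (snd p)) \<in> borel_measurable (L \<Otimes>\<^sub>M config_algebra L)"
    using G by (simp add: case_prod_unfold)
  note [measurable] = Gm
  \<comment> \<open>The last factor asks that x be a simple point. It is written with the level set
    of \<phi>, which for x in \<open>B\<close> equals {x}, to make it jointly measurable.\<close>
  define f where "f x \<mu> = G x \<mu> * indicator B x * (if empty_after \<mu> x then 1 else 0)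
        * (if emeasure \<mu> {y \<in> B. \<phi> y = \<phi> x} = 1 then 1 else 0)" for x \<mu>
  \<comment> \<open>For fixed x this factor is unaffected by points added in
    \<open>nearby x\<close>, as the comparison of void probabilities demands.\<close>
  define F where "F x \<mu> = G x \<mu> * (if empty_after \<mu> x then 1 else 0) * (if isolated \<mu> x then 1 else 0)" for x \<mu>
  define k where "k x = indicator B x * \<kappa> x (null_measure L)" for x
  define v where "v x \<mu> = (if emeasure \<mu> (nearby x) = 0 then 1 else 0 :: real)" for x \<mu>
  have F_nonneg: "0 \<le> F x \<mu>" if "x \<in> space L" "\<mu> \<in> configs L" for x \<mu>
    using G_nonneg[OF that] by (simp add: F_def)
  have k_nonneg: "0 \<le> k x" if "x \<in> space L" for x
    using kappa_nonneg[OF that null_measure_configs] by (simp add: k_def)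
  have [measurable]: "k \<in> borel_measurable L"
    unfolding k_def by measurable
  have Fm [measurable]: "(\<lambda>p. F (fst p) (snd p)) \<in> borel_measurable (L \<Otimes>\<^sub>M config_algebra L)"
    unfolding F_def by measurable
  have vm [measurable]: "(\<lambda>p. v (fst p) (snd p)) \<in> borel_measurable (L \<Otimes>\<^sub>M config_algebra L)"
  proof -
    have "Measurable.pred (L \<Otimes>\<^sub>M L) (\<lambda>p. (\<phi> (snd p) = \<phi> (fst p) \<or> R (fst p) (snd p)) \<and>
      \<not> \<phi> (fst p) < \<phi> (snd p))" by measurable
    note section_in_B_measurable[of "\<lambda>x y. (\<phi> y = \<phi> x \<or> R x y) \<and> \<not> \<phi> x < \<phi> y", OF this, measurable]
    have "(\<lambda>p. if emeasure (snd p) {y \<in> B. (\<phi> y = \<phi> (fst p) \<or> R (fst p) y) \<and> \<not> \<phi> (fst p) < \<phi> y} = 0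
        then 1 else 0 :: real) \<in> borel_measurable (L \<Otimes>\<^sub>M config_algebra L)" by measurable
    also have "?this \<longleftrightarrow> ?thesis"
    proof (rule measurable_cong)
      fix p assume "p \<in> space (L \<Otimes>\<^sub>M config_algebra L)"
      then have "fst p \<in> space L" by (auto simp: space_pair_measure)
      then have "{y \<in> B. (\<phi> y = \<phi> (fst p) \<or> R (fst p) y) \<and> \<not> \<phi> (fst p) < \<phi> y} = nearby (fst p)"
        using B_space phi_eq_iff by (auto simp: nearby_def)
      then show "(if emeasure (snd p) {y \<in> B. (\<phi> y = \<phi> (fst p) \<or> R (fst p) y) \<and> \<not> \<phi> (fst p) < \<phi> y} = 0
        then 1 else 0) = v (fst p) (snd p)" by (simp add: v_def)
    qed
    finally show ?thesis .
  qed
  have xi_pair: "(\<lambda>(x, \<omega>). h (x, \<xi> \<omega>)) \<in> borel_measurable (L \<Otimes>\<^sub>M P)"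
    if "h \<in> borel_measurable (L \<Otimes>\<^sub>M config_algebra L)" for h :: "_ \<Rightarrow> ennreal"
  proof -
    have "(\<lambda>p. (fst p, \<xi> (snd p))) \<in> L \<Otimes>\<^sub>M P \<rightarrow>\<^sub>M L \<Otimes>\<^sub>M config_algebra L" by measurable
    from measurable_compose[OF this that] show ?thesis by (simp add: case_prod_unfold)
  qed
  have single: "{y \<in> B. \<phi> y = \<phi> x} = {x}" if "x \<in> B" for x
    using that B_space phi_eq_iff by auto
  have "(\<integral>\<^sup>+\<omega>. (\<integral>\<^sup>+x. ennreal (G x (\<xi> \<omega>) * (if empty_after (\<xi> \<omega>) x then 1 else 0) * intens (\<xi> \<omega>) x) \<partial>L) \<partial>P)
      = (\<integral>\<^sup>+\<omega>. (\<integral>\<^sup>+x. ennreal (k x * exp (- nb_mass x)) * ennreal (F x (\<xi> \<omega>)) \<partial>L) \<partial>P)"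
  proof (intro nn_integral_cong)
    fix \<omega> x assume x: "x \<in> space L"
    have "G x (\<xi> \<omega>) * (if empty_after (\<xi> \<omega>) x then 1 else 0) * intens (\<xi> \<omega>) x
        = (k x * exp (- nb_mass x)) * F x (\<xi> \<omega>)"
      by (simp add: intens_def F_def k_def)
    also have "ennreal \<dots> = ennreal (k x * exp (- nb_mass x)) * ennreal (F x (\<xi> \<omega>))"
      using k_nonneg[OF x] by (intro ennreal_mult') simp
    finally show "ennreal (G x (\<xi> \<omega>) * (if empty_after (\<xi> \<omega>) x then 1 else 0) * intens (\<xi> \<omega>) x) =
        ennreal (k x * exp (- nb_mass x)) * ennreal (F x (\<xi> \<omega>))" .
  qed
  \<comment> \<open>The set to be emptied depends on x, so the integral over outcomes is moved
    inside and the comparison is made for each x separately.\<close>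
  also have "\<dots> = (\<integral>\<^sup>+x. (\<integral>\<^sup>+\<omega>. ennreal (k x * exp (- nb_mass x)) * ennreal (F x (\<xi> \<omega>)) \<partial>P) \<partial>L)"
  proof (rule LP.Fubini')
    have "(\<lambda>p. ennreal (k (fst p) * exp (- nb_mass (fst p))) * ennreal (F (fst p) (snd p)))
        \<in> borel_measurable (L \<Otimes>\<^sub>M config_algebra L)" by measurable
    from xi_pair[OF this]
    show "(\<lambda>(x, \<omega>). ennreal (k x * exp (- nb_mass x)) * ennreal (F x (\<xi> \<omega>))) \<in> borel_measurable (L \<Otimes>\<^sub>M P)"
      by simp
  qed
  also have "\<dots> \<le> (\<integral>\<^sup>+x. (\<integral>\<^sup>+\<omega>. ennreal (k x) * ennreal (F x (\<xi> \<omega>) * v x (\<xi> \<omega>)) \<partial>P) \<partial>L)"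
  proof (rule nn_integral_mono)
    fix x assume x: "x \<in> space L"
    have Fx [measurable]: "F x \<in> borel_measurable (config_algebra L)"
      using measurable_compose[OF measurable_Pair1'[OF x] Fm] by simp
    have vx [measurable]: "v x \<in> borel_measurable (config_algebra L)"
      using measurable_compose[OF measurable_Pair1'[OF x] vm] by simp
    have "(\<integral>\<^sup>+\<omega>. ennreal (F x (\<xi> \<omega>)) \<partial>P) \<le>
        ennreal (exp (measure dom (nearby x))) * (\<integral>\<^sup>+\<omega>. ennreal (F x (\<xi> \<omega>) * v x (\<xi> \<omega>)) \<partial>P)"
      unfolding v_def
    proof (rule nn_integral_le_exp_void[OF nearby_sets[OF x] nearby_finite Fx F_nonneg[OF x]])
      fix \<mu> y assume \<mu>: "\<mu> \<in> configs L" and "y \<in> nearby x"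
      then have y: "y \<in> B" "\<not> \<phi> x < \<phi> y" by (auto simp: nearby_def)
      then show "F x (add_point \<mu> y) = F x \<mu>"
        using \<mu> x by (simp add: F_def G_add isolated_add_point empty_after_add_point)
    qed
    also have "\<dots> \<le> ennreal (exp (nb_mass x)) * (\<integral>\<^sup>+\<omega>. ennreal (F x (\<xi> \<omega>) * v x (\<xi> \<omega>)) \<partial>P)"
      using measure_nearby_le[OF x] by (intro mult_right_mono ennreal_leI) auto
    finally have le: "(\<integral>\<^sup>+\<omega>. ennreal (F x (\<xi> \<omega>)) \<partial>P) \<le>
        ennreal (exp (nb_mass x)) * (\<integral>\<^sup>+\<omega>. ennreal (F x (\<xi> \<omega>) * v x (\<xi> \<omega>)) \<partial>P)" .
    \<comment> \<open>The factor \<open>exp (- nb_mass x)\<close> built into \<open>intens\<close>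
      pays exactly for emptying the neighbourhood.\<close>
    have cancel: "ennreal (k x * exp (- nb_mass x)) * ennreal (exp (nb_mass x)) = ennreal (k x)"
      using k_nonneg[OF x] by (simp add: ennreal_mult'[symmetric] exp_minus)
    have "(\<integral>\<^sup>+\<omega>. ennreal (k x * exp (- nb_mass x)) * ennreal (F x (\<xi> \<omega>)) \<partial>P) =
        ennreal (k x * exp (- nb_mass x)) * (\<integral>\<^sup>+\<omega>. ennreal (F x (\<xi> \<omega>)) \<partial>P)"
      by (rule nn_integral_cmult) measurable
    also have "\<dots> \<le> ennreal (k x * exp (- nb_mass x)) *
        (ennreal (exp (nb_mass x)) * (\<integral>\<^sup>+\<omega>. ennreal (F x (\<xi> \<omega>) * v x (\<xi> \<omega>)) \<partial>P))"
      by (intro mult_left_mono le) simp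
    also have "\<dots> = ennreal (k x) * (\<integral>\<^sup>+\<omega>. ennreal (F x (\<xi> \<omega>) * v x (\<xi> \<omega>)) \<partial>P)"
      by (simp only: mult.assoc[symmetric] cancel)
    also have "\<dots> = (\<integral>\<^sup>+\<omega>. ennreal (k x) * ennreal (F x (\<xi> \<omega>) * v x (\<xi> \<omega>)) \<partial>P)"
      by (rule nn_integral_cmult[symmetric]) measurable
    finally show "(\<integral>\<^sup>+\<omega>. ennreal (k x * exp (- nb_mass x)) * ennreal (F x (\<xi> \<omega>)) \<partial>P) \<le>
        (\<integral>\<^sup>+\<omega>. ennreal (k x) * ennreal (F x (\<xi> \<omega>) * v x (\<xi> \<omega>)) \<partial>P)" .
  qed
  also have "\<dots> = (\<integral>\<^sup>+\<omega>. (\<integral>\<^sup>+x. ennreal (k x) * ennreal (F x (\<xi> \<omega>) * v x (\<xi> \<omega>)) \<partial>L) \<partial>P)"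
  proof (rule LP.Fubini'[symmetric])
    have "(\<lambda>p. ennreal (k (fst p)) * ennreal (F (fst p) (snd p) * v (fst p) (snd p)))
        \<in> borel_measurable (L \<Otimes>\<^sub>M config_algebra L)" by measurable
    from xi_pair[OF this]
    show "(\<lambda>(x, \<omega>). ennreal (k x) * ennreal (F x (\<xi> \<omega>) * v x (\<xi> \<omega>))) \<in> borel_measurable (L \<Otimes>\<^sub>M P)"
      by simp
  qed
  also have "\<dots> \<le> (\<integral>\<^sup>+\<omega>. (\<integral>\<^sup>+x. ennreal (f x (add_point (\<xi> \<omega>) x)) * ennreal (\<kappa> x (\<xi> \<omega>)) \<partial>L) \<partial>P)"
  proof (intro nn_integral_mono)
    fix \<omega> x assume "\<omega> \<in> space P" and x: "x \<in> space L"
    then have \<mu>: "\<xi> \<omega> \<in> configs L" by (intro xi_configs)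
    show "ennreal (k x) * ennreal (F x (\<xi> \<omega>) * v x (\<xi> \<omega>)) \<le>
        ennreal (f x (add_point (\<xi> \<omega>) x)) * ennreal (\<kappa> x (\<xi> \<omega>))"
    proof (cases "x \<in> B \<and> isolated (\<xi> \<omega>) x \<and> empty_after (\<xi> \<omega>) x \<and> emeasure (\<xi> \<omega>) (nearby x) = 0")
      case True
      then have "\<kappa> x (\<xi> \<omega>) = k x" using kappa_eq_kappa_null[OF x \<mu>] by (simp add: k_def)
      \<comment> \<open>Since x lies in \<open>nearby x\<close>, the configuration has no mass at x,
        and adding x gives mass exactly 1 there.\<close>
      moreover have "emeasure (\<xi> \<omega>) {x} = 0"
      proof -
        have "emeasure (\<xi> \<omega>) {x} \<le> emeasure (\<xi> \<omega>) (nearby x)"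
          using True nearby_sets[OF x] by (intro emeasure_mono) (auto simp: nearby_def configs_sets[OF \<mu>])
        then show ?thesis using True by simp
      qed
      then have "f x (add_point (\<xi> \<omega>) x) = F x (\<xi> \<omega>)"
        using True \<mu> x singleton_sets[OF x]
        by (simp add: f_def F_def G_add empty_after_add_point single emeasure_add_point configs_sets)
      ultimately show ?thesis using True by (simp add: v_def mult.commute)
    next
      case False
      then have "k x * (F x (\<xi> \<omega>) * v x (\<xi> \<omega>)) = 0" by (auto simp: k_def F_def v_def)
      then have "ennreal (k x) * ennreal (F x (\<xi> \<omega>) * v x (\<xi> \<omega>)) = 0"
        using k_nonneg[OF x] by (subst ennreal_mult'[symmetric]) auto
      then show ?thesis by (simp only: zero_le)
    qed
  qed
  also have "\<dots> = (\<integral>\<^sup>+\<omega>. (\<integral>\<^sup>+x. ennreal (f x (\<xi> \<omega>)) \<partial>(\<xi> \<omega>)) \<partial>P)"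
  proof (rule gnz[symmetric])
    have "Measurable.pred (L \<Otimes>\<^sub>M L) (\<lambda>p. \<phi> (snd p) = \<phi> (fst p))" by measurable
    note section_in_B_measurable[of "\<lambda>x y. \<phi> y = \<phi> x", OF this, measurable]
    have "(\<lambda>p. f (fst p) (snd p)) \<in> borel_measurable (L \<Otimes>\<^sub>M config_algebra L)"
      unfolding f_def by measurable
    then show "(\<lambda>(x, \<mu>). f x \<mu>) \<in> borel_measurable (L \<Otimes>\<^sub>M config_algebra L)"
      by (simp add: case_prod_unfold)
  qed (simp add: f_def G_nonneg)
  finally show ?thesis by (simp add: f_def)
qed

lemma total_mass_add_point:
  "\<mu> \<in> configs L \<Longrightarrow> y \<in> B \<Longrightarrow> total_mass (add_point \<mu> y) = total_mass \<mu>"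
  by (simp add: total_mass_def intens_measure_add_point)

lemma total_mass_nonneg: "0 \<le> total_mass \<mu>"
  by (simp add: total_mass_def)

text \<open>
  The weight \<open>exp (tail_mass \<mu> x)\<close> solves \<open>K(T) = 1 + \<integral> K(x) 1{\<phi> x > T} intens \<mu> x \<lambda>(dx)\<close>, so at the
  last point \<open>T\<close> of \<open>\<mu>\<close> in \<open>B\<close> the Gibbs equation loses exactly the constant \<open>1\<close>.
\<close>

lemma nn_integral_last_point_le:
  assumes \<mu>: "\<mu> \<in> configs L" and ne: "emeasure \<mu> B \<noteq> 0" and h: "0 \<le> h"
  shows "(\<integral>\<^sup>+x. ennreal (h * exp (tail_mass \<mu> x) * indicator B x * (if empty_after \<mu> x then 1 else 0)
        * (if emeasure \<mu> {y \<in> B. \<phi> y = \<phi> x} = 1 then 1 else 0)) \<partial>\<mu>)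
    \<le> ennreal h + (\<integral>\<^sup>+x. ennreal (h * exp (tail_mass \<mu> x) * (if empty_after \<mu> x then 1 else 0) * intens \<mu> x) \<partial>L)"
    (is "?l \<le> _ + ?r")
proof -
  have [simp]: "sets \<mu> = sets L" "space \<mu> = space L"
    using \<mu> by (simp_all add: configs_sets configs_space)
  obtain T where T: "T \<in> B" "emeasure \<mu> {T} \<noteq> 0" "emeasure \<mu> {y \<in> B. \<phi> T < \<phi> y} = 0"
    using last_atom[OF phi \<mu> B ne] by auto
  note TL = B_space[OF T(1)]
  have single: "{y \<in> B. \<phi> y = \<phi> T} = {T}"
    using T(1) B_space phi_eq_iff by auto
  have before: "\<not> empty_after \<mu> x" if "\<phi> x < \<phi> T" for x
  proof
    assume "empty_after \<mu> x"
    moreover have "emeasure \<mu> {T} \<le> emeasure \<mu> {y \<in> B. \<phi> x < \<phi> y}"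
      using that T(1) empty_after_sets by (intro emeasure_mono) auto
    ultimately show False using T(2) by (simp add: empty_after_def)
  qed
  have after: "empty_after \<mu> x" if "\<phi> T < \<phi> x" for x
  proof -
    have "emeasure \<mu> {y \<in> B. \<phi> x < \<phi> y} \<le> emeasure \<mu> {y \<in> B. \<phi> T < \<phi> y}"
      using that empty_after_sets by (intro emeasure_mono) auto
    then show ?thesis using T(3) by (simp add: empty_after_def)
  qed
  \<comment> \<open>Multiplicity is harmless: the integrand vanishes unless \<open>T\<close> has
    mass 1, and then integrating against \<mu> contributes the weight once.\<close>
  define c where "c = h * exp (tail_mass \<mu> T) * (if emeasure \<mu> {T} = 1 then 1 else 0)"
  have "{y \<in> B. \<phi> T < \<phi> y} \<in> null_sets \<mu>" using T(3) empty_after_sets by auto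
  then have ae: "AE x in \<mu>. \<not> (x \<in> B \<and> \<phi> T < \<phi> x)"
    by (auto dest!: AE_not_in)
  have "?l \<le> (\<integral>\<^sup>+x. ennreal c * indicator {T} x \<partial>\<mu>)"
  proof (rule nn_integral_mono_AE)
    show "AE x in \<mu>. ennreal (h * exp (tail_mass \<mu> x) * indicator B x * (if empty_after \<mu> x then 1 else 0)
        * (if emeasure \<mu> {y \<in> B. \<phi> y = \<phi> x} = 1 then 1 else 0)) \<le> ennreal c * indicator {T} x"
      using ae
    proof eventually_elim
      case (elim x)
      consider "x = T" | "x \<notin> B" | "\<phi> x < \<phi> T"
        using elim B_space T(1) phi_eq_iff by (metis linorder_neqE)
      then show ?case
      proof cases
        case 1
        then show ?thesis using T(1) h by (auto simp: c_def single)
      qed (auto dest: before)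
    qed
  qed
  also have "\<dots> = ennreal c * emeasure \<mu> {T}"
    using singleton_sets[OF TL] by (simp add: nn_integral_cmult_indicator)
  also have "\<dots> \<le> ennreal (h * exp (tail_mass \<mu> T))"
    by (simp add: c_def)
  also have "\<dots> = ennreal h + ennreal h * ennreal (exp (tail_mass \<mu> T) - 1)"
  proof -
    have "0 \<le> exp (tail_mass \<mu> T) - 1" by (simp add: tail_mass_def)
    then have "ennreal (h + h * (exp (tail_mass \<mu> T) - 1)) =
        ennreal h + ennreal h * ennreal (exp (tail_mass \<mu> T) - 1)"
      using h by (subst ennreal_plus) (auto simp: ennreal_mult')
    then show ?thesis by (simp add: algebra_simps)
  qed
  \<comment> \<open>The exponential inequality on the part after \<open>T\<close>, whose total mass
    is \<open>tail_mass \<mu> T\<close>. All points x of that part satisfy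
    \<open>empty_after \<mu> x\<close>, so their contribution is contained in the integral on the
    right.\<close>
  also have "\<dots> \<le> ennreal h + ennreal h *
      (\<integral>\<^sup>+x. ennreal (exp (tail_mass \<mu> x)) * (ennreal (intens \<mu> x) * indicator {y \<in> space L. \<phi> T < \<phi> y} x) \<partial>L)"
    using exp_mass_le_nn_integral[OF \<mu>, of "{y \<in> space L. \<phi> T < \<phi> y}"]
    by (intro add_left_mono mult_left_mono) (auto simp: tail_mass_def)
  also have "\<dots> \<le> ennreal h + ?r"
  proof (intro add_left_mono)
    have [measurable]: "intens \<mu> \<in> borel_measurable L" using \<mu> by (rule intens_measurable_fst)
    have [measurable]: "tail_mass \<mu> \<in> borel_measurable L"
      using measurable_compose[OF measurable_Pair2' tail_mass_measurable, of \<mu>] \<mu>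
      by (simp add: space_config_algebra)
    have "ennreal h * (\<integral>\<^sup>+x. ennreal (exp (tail_mass \<mu> x)) * (ennreal (intens \<mu> x) * indicator {y \<in> space L. \<phi> T < \<phi> y} x) \<partial>L)
      = (\<integral>\<^sup>+x. ennreal h * (ennreal (exp (tail_mass \<mu> x)) * (ennreal (intens \<mu> x) * indicator {y \<in> space L. \<phi> T < \<phi> y} x)) \<partial>L)"
      by (rule nn_integral_cmult[symmetric]) measurable
    also have "\<dots> \<le> ?r"
    proof (rule nn_integral_mono)
      fix x assume x: "x \<in> space L"
      show "ennreal h * (ennreal (exp (tail_mass \<mu> x)) * (ennreal (intens \<mu> x) * indicator {y \<in> space L. \<phi> T < \<phi> y} x))
        \<le> ennreal (h * exp (tail_mass \<mu> x) * (if empty_after \<mu> x then 1 else 0) * intens \<mu> x)"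
        using h x after[of x] intens_nonneg[OF x]
        by (cases "\<phi> T < \<phi> x") (simp_all add: ennreal_mult' mult.assoc)
    qed
    finally show "ennreal h * (\<integral>\<^sup>+x. ennreal (exp (tail_mass \<mu> x)) * (ennreal (intens \<mu> x) * indicator {y \<in> space L. \<phi> T < \<phi> y} x) \<partial>L) \<le> ?r" .
  qed
  finally show ?thesis .
qed

text \<open>Let W be the integral of the weight \<open>H \<mu> * exp (tail_mass \<mu> x)\<close>
  against the intensity over the x with nothing after them. On the void event W is at least H (exp q
  - 1), with q the total mass, and there is no last point. Otherwise the last point contributes at
  most H + W. In the Gibbs inequality the expectation of W on the non-void event appears on both
  sides and cancels.\<close>

lemma nn_integral_void_le:
  fixes H :: "'a measure \<Rightarrow> real"
  assumes H [measurable]: "H \<in> borel_measurable (config_algebra L)"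
    and H01: "\<And>\<mu>. \<mu> \<in> configs L \<Longrightarrow> 0 \<le> H \<mu>" "\<And>\<mu>. \<mu> \<in> configs L \<Longrightarrow> H \<mu> \<le> 1"
    and H_add: "\<And>\<mu> y. \<mu> \<in> configs L \<Longrightarrow> y \<in> B \<Longrightarrow> H (add_point \<mu> y) = H \<mu>"
  shows "(\<integral>\<^sup>+\<omega>. ennreal (H (\<xi> \<omega>) * (exp (total_mass (\<xi> \<omega>)) - 1)
      * (if emeasure (\<xi> \<omega>) B = 0 then 1 else 0)) \<partial>P)
    \<le> (\<integral>\<^sup>+\<omega>. ennreal (H (\<xi> \<omega>) * (if emeasure (\<xi> \<omega>) B = 0 then 0 else 1)) \<partial>P)"
proof -
  define G where "G x \<mu> = H \<mu> * exp (tail_mass \<mu> x)" for x \<mu>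
  have Gm [measurable]: "(\<lambda>p. G (fst p) (snd p)) \<in> borel_measurable (L \<Otimes>\<^sub>M config_algebra L)"
    unfolding G_def by measurable
  define w where "w x \<mu> = G x \<mu> * (if empty_after \<mu> x then 1 else 0) * intens \<mu> x" for x \<mu>
  have [measurable]: "(\<lambda>p. w (fst p) (snd p)) \<in> borel_measurable (L \<Otimes>\<^sub>M config_algebra L)"
    unfolding w_def by measurable
  define W where "W \<omega> = (\<integral>\<^sup>+x. ennreal (w x (\<xi> \<omega>)) \<partial>L)" for \<omega>
  have [measurable]: "W \<in> borel_measurable P"
  proof -
    have "(\<lambda>p. (snd p, \<xi> (fst p))) \<in> P \<Otimes>\<^sub>M L \<rightarrow>\<^sub>M L \<Otimes>\<^sub>M config_algebra L" by measurable
    from measurable_compose[OF this, of "\<lambda>p. w (fst p) (snd p)" borel]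
    have [measurable]: "(\<lambda>p. w (snd p) (\<xi> (fst p))) \<in> borel_measurable (P \<Otimes>\<^sub>M L)" by simp
    show ?thesis unfolding W_def by measurable
  qed
  define A where "A = {\<omega> \<in> space P. emeasure (\<xi> \<omega>) B = 0}"
  have [measurable]: "A \<in> sets P" unfolding A_def by measurable
  have W_void: "ennreal (H (\<xi> \<omega>) * (exp (total_mass (\<xi> \<omega>)) - 1)) \<le> W \<omega>" if "\<omega> \<in> A" for \<omega>
  proof -
    have \<mu>: "\<xi> \<omega> \<in> configs L" and void: "emeasure (\<xi> \<omega>) B = 0"
      using that xi_configs by (auto simp: A_def)
    have ea: "empty_after (\<xi> \<omega>) x" for x
    proof -
      have "emeasure (\<xi> \<omega>) {y \<in> B. \<phi> x < \<phi> y} \<le> emeasure (\<xi> \<omega>) B"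
        by (intro emeasure_mono) (auto simp: configs_sets[OF \<mu>])
      then show ?thesis using void by (simp add: empty_after_def)
    qed
    have [measurable]: "intens (\<xi> \<omega>) \<in> borel_measurable L" using \<mu> by (rule intens_measurable_fst)
    have [measurable]: "tail_mass (\<xi> \<omega>) \<in> borel_measurable L"
      using measurable_compose[OF measurable_Pair2' tail_mass_measurable, of "\<xi> \<omega>"] \<mu>
      by (simp add: space_config_algebra)
    have "ennreal (H (\<xi> \<omega>) * (exp (total_mass (\<xi> \<omega>)) - 1)) =
        ennreal (H (\<xi> \<omega>)) * ennreal (exp (total_mass (\<xi> \<omega>)) - 1)"
      using H01[OF \<mu>] by (simp add: ennreal_mult')
    also have "\<dots> \<le> ennreal (H (\<xi> \<omega>)) *
        (\<integral>\<^sup>+x. ennreal (exp (tail_mass (\<xi> \<omega>) x)) * (ennreal (intens (\<xi> \<omega>) x) * indicator (space L) x) \<partial>L)"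
      unfolding total_mass_def by (intro mult_left_mono exp_mass_le_nn_integral \<mu>) auto
    also have "\<dots> = (\<integral>\<^sup>+x. ennreal (H (\<xi> \<omega>)) *
        (ennreal (exp (tail_mass (\<xi> \<omega>) x)) * (ennreal (intens (\<xi> \<omega>) x) * indicator (space L) x)) \<partial>L)"
      by (rule nn_integral_cmult[symmetric]) measurable
    also have "\<dots> = W \<omega>"
      unfolding W_def w_def G_def using ea H01[OF \<mu>] intens_nonneg
      by (intro nn_integral_cong) (simp add: ennreal_mult' mult.assoc)
    finally show ?thesis .
  qed
  have W_fin: "W \<omega> \<le> ennreal (exp (measure dom B) * measure dom B)" if "\<omega> \<in> space P" for \<omega>
  proof -
    have \<mu>: "\<xi> \<omega> \<in> configs L" using that by (rule xi_configs)
    have [measurable]: "intens (\<xi> \<omega>) \<in> borel_measurable L" using \<mu> by (rule intens_measurable_fst)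
    have "W \<omega> \<le> (\<integral>\<^sup>+x. ennreal (exp (measure dom B)) * (ennreal (intens (\<xi> \<omega>) x) * indicator (space L) x) \<partial>L)"
      unfolding W_def
    proof (rule nn_integral_mono)
      fix x assume x: "x \<in> space L"
      have "tail_mass (\<xi> \<omega>) x \<le> measure dom B"
        unfolding tail_mass_def by (intro measure_intens_measure_le \<mu>) measurable
      then have "w x (\<xi> \<omega>) \<le> 1 * exp (measure dom B) * 1 * intens (\<xi> \<omega>) x"
        unfolding w_def G_def using H01[OF \<mu>] intens_nonneg[OF x]
        by (intro mult_mono mult_nonneg_nonneg) auto
      then have "ennreal (w x (\<xi> \<omega>)) \<le> ennreal (exp (measure dom B) * intens (\<xi> \<omega>) x)"
        by (intro ennreal_leI) simp
      then show "ennreal (w x (\<xi> \<omega>)) \<le>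
          ennreal (exp (measure dom B)) * (ennreal (intens (\<xi> \<omega>) x) * indicator (space L) x)"
        using x by (simp add: ennreal_mult')
    qed
    also have "\<dots> = ennreal (exp (measure dom B)) * emeasure (intens_measure (\<xi> \<omega>)) (space L)"
      using \<mu> by (subst nn_integral_cmult) (auto simp: emeasure_intens_measure)
    also have "\<dots> \<le> ennreal (exp (measure dom B)) * ennreal (measure dom B)"
      using \<mu> by (intro mult_left_mono emeasure_intens_measure_le) auto
    finally show ?thesis by (simp add: ennreal_mult')
  qed
  \<comment> \<open>Needed for the cancellation: an infinite common term could not be removed from
    an inequality in the extended reals.\<close>
  have fin: "(\<integral>\<^sup>+\<omega>. W \<omega> * indicator (space P - A) \<omega> \<partial>P) < \<infinity>"
  proof -
    have "(\<integral>\<^sup>+\<omega>. W \<omega> * indicator (space P - A) \<omega> \<partial>P) \<le>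
        (\<integral>\<^sup>+\<omega>. ennreal (exp (measure dom B) * measure dom B) \<partial>P)"
      using W_fin by (intro nn_integral_mono) (auto simp: indicator_def)
    also have "\<dots> = ennreal (exp (measure dom B) * measure dom B)"
      by (simp add: P.emeasure_space_1)
    finally show ?thesis by (simp add: le_less_trans)
  qed
  let ?l = "\<integral>\<^sup>+\<omega>. ennreal (H (\<xi> \<omega>) * (exp (total_mass (\<xi> \<omega>)) - 1) * (if emeasure (\<xi> \<omega>) B = 0 then 1 else 0)) \<partial>P"
  let ?r = "\<integral>\<^sup>+\<omega>. ennreal (H (\<xi> \<omega>) * (if emeasure (\<xi> \<omega>) B = 0 then 0 else 1)) \<partial>P"
  have "(\<integral>\<^sup>+\<omega>. W \<omega> * indicator (space P - A) \<omega> \<partial>P) + ?l \<le>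
      (\<integral>\<^sup>+\<omega>. W \<omega> * indicator (space P - A) \<omega> \<partial>P) + (\<integral>\<^sup>+\<omega>. W \<omega> * indicator A \<omega> \<partial>P)"
    using W_void by (intro add_left_mono nn_integral_mono) (auto simp: A_def)
  also have "\<dots> = (\<integral>\<^sup>+\<omega>. W \<omega> * indicator (space P - A) \<omega> + W \<omega> * indicator A \<omega> \<partial>P)"
    by (rule nn_integral_add[symmetric]) measurable
  also have "\<dots> = (\<integral>\<^sup>+\<omega>. W \<omega> \<partial>P)"
    by (intro nn_integral_cong) (auto simp: indicator_def)
  also have "\<dots> \<le> (\<integral>\<^sup>+\<omega>. (\<integral>\<^sup>+x. ennreal (G x (\<xi> \<omega>) * indicator B x * (if empty_after (\<xi> \<omega>) x then 1 else 0)
        * (if emeasure (\<xi> \<omega>) {y \<in> B. \<phi> y = \<phi> x} = 1 then 1 else 0)) \<partial>(\<xi> \<omega>)) \<partial>P)"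
    unfolding W_def w_def
  proof (rule nn_integral_last_point_ge)
    show "(\<lambda>(x, \<mu>). G x \<mu>) \<in> borel_measurable (L \<Otimes>\<^sub>M config_algebra L)"
      using Gm by (simp add: case_prod_unfold)
  qed (simp_all add: G_def H01 H_add tail_mass_add_point)
  also have "\<dots> \<le> (\<integral>\<^sup>+\<omega>. W \<omega> * indicator (space P - A) \<omega> +
      ennreal (H (\<xi> \<omega>) * (if emeasure (\<xi> \<omega>) B = 0 then 0 else 1)) \<partial>P)"
  proof (rule nn_integral_mono)
    fix \<omega> assume \<omega>: "\<omega> \<in> space P"
    have \<mu>: "\<xi> \<omega> \<in> configs L" using \<omega> by (rule xi_configs)
    show "(\<integral>\<^sup>+x. ennreal (G x (\<xi> \<omega>) * indicator B x * (if empty_after (\<xi> \<omega>) x then 1 else 0)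
        * (if emeasure (\<xi> \<omega>) {y \<in> B. \<phi> y = \<phi> x} = 1 then 1 else 0)) \<partial>(\<xi> \<omega>)) \<le>
      W \<omega> * indicator (space P - A) \<omega> +
      ennreal (H (\<xi> \<omega>) * (if emeasure (\<xi> \<omega>) B = 0 then 0 else 1))"
    proof (cases "emeasure (\<xi> \<omega>) B = 0")
      case True
      have sB: "B \<in> sets (\<xi> \<omega>)" using configs_sets[OF \<mu>] by simp
      have "B \<in> null_sets (\<xi> \<omega>)" using True sB by auto
      \<comment> \<open>On the void event the integral against the configuration vanishes, so
        nothing has to be paid on the right.\<close>
      then have "AE x in \<xi> \<omega>. x \<notin> B" by (rule AE_not_in)
      then have "(\<integral>\<^sup>+x. ennreal (G x (\<xi> \<omega>) * indicator B x * (if empty_after (\<xi> \<omega>) x then 1 else 0)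
        * (if emeasure (\<xi> \<omega>) {y \<in> B. \<phi> y = \<phi> x} = 1 then 1 else 0)) \<partial>(\<xi> \<omega>)) = (\<integral>\<^sup>+x. 0 \<partial>(\<xi> \<omega>))"
        by (intro nn_integral_cong_AE) (auto elim!: eventually_mono)
      then show ?thesis by simp
    next
      case False
      then show ?thesis
        using nn_integral_last_point_le[OF \<mu> False H01(1)[OF \<mu>]] \<omega>
        by (simp add: W_def w_def G_def A_def add.commute)
    qed
  qed
  also have "\<dots> = (\<integral>\<^sup>+\<omega>. W \<omega> * indicator (space P - A) \<omega> \<partial>P) + ?r"
    by (rule nn_integral_add) measurable
  finally show ?thesis
    using fin by (auto simp: ennreal_add_left_cancel_le)
qed

section \<open>From test functions to the conditional void probability\<close>

lemma total_mass_restr: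
  assumes \<mu>: "\<mu> \<in> configs L"
  shows "total_mass (restr_measure \<mu> (space L - B)) = total_mass \<mu>"
proof -
  have "isolated (restr_measure \<mu> (space L - B)) x \<longleftrightarrow> isolated \<mu> x" if x: "x \<in> space L" for x
  proof -
    have "{z \<in> space L - B. R x z} = {z \<in> space L. z \<notin> B \<and> R x z}" by auto
    also have "\<dots> \<in> sets L" using x by measurable
    moreover have "(space L - B) \<inter> {z \<in> space L - B. R x z} = {z \<in> space L - B. R x z}" by auto
    ultimately show ?thesis
      using \<mu> by (simp add: isolated_def emeasure_restr_measure configs_sets)
  qed
  then have "intens (restr_measure \<mu> (space L - B)) x = intens \<mu> x" for x
    using B_space by (cases "x \<in> B") (auto simp: intens_def)
  then show ?thesis by (simp add: total_mass_def intens_measure_def)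
qed

text \<open>By \<open>real_cond_exp_leI\<close> it is enough to compare integrals over the sets of
  the conditioning \<sigma>-field. Such a set is given by the configuration outside
  \<open>B\<close>, so its indicator times exp (- q) is an admissible choice of H.\<close>

lemma cond_void_prob_le:
  "AE \<omega> in P. cond_prob_given P (config_algebra L) (\<lambda>\<omega>. restr_measure (\<xi> \<omega>) (space L - B))
      {\<omega> \<in> space P. emeasure (\<xi> \<omega>) B = 0} \<omega> \<le> exp (- total_mass (\<xi> \<omega>))"
proof -
  define C where "C = space L - B"
  have C: "C \<in> sets L" by (simp add: C_def)
  define Y where "Y \<omega> = restr_measure (\<xi> \<omega>) C" for \<omega>
  define A where "A = {\<omega> \<in> space P. emeasure (\<xi> \<omega>) B = 0}"
  have [measurable]: "A \<in> sets P" unfolding A_def by measurable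
  have Y [measurable]: "Y \<in> P \<rightarrow>\<^sub>M config_algebra L"
    unfolding Y_def using measurable_compose[OF xi_measurable measurable_restr_measure[OF C]] .
  define \<F> where "\<F> = vimage_algebra (space P) Y (config_algebra L)"
  have Y_space: "Y \<in> space P \<rightarrow> space (config_algebra L)" using measurable_space[OF Y] by auto
  have YF: "Y \<in> \<F> \<rightarrow>\<^sub>M config_algebra L"
    unfolding \<F>_def by (rule measurable_vimage_algebra1[OF Y_space])
  have sub: "subalgebra P \<F>"
    unfolding subalgebra_def \<F>_def using sets_image_in_sets[OF refl Y] by simp
  interpret F: finite_measure_subalgebra P \<F>
    using sub by unfold_locales
  \<comment> \<open>The exponent depends only on the configuration outside \<open>B\<close>; this
    makes the bound measurable for the conditioning \<sigma>-field.\<close>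
  have mass: "total_mass (\<xi> \<omega>) = total_mass (Y \<omega>)" if "\<omega> \<in> space P" for \<omega>
    using total_mass_restr[OF xi_configs[OF that]] by (simp add: Y_def C_def)
  define r where "r \<omega> = exp (- total_mass (Y \<omega>))" for \<omega>
  have r_le: "0 \<le> r \<omega>" "r \<omega> \<le> 1" for \<omega>
    using total_mass_nonneg by (auto simp: r_def)
  have r: "r \<in> borel_measurable \<F>" "r \<in> borel_measurable P"
    unfolding r_def using measurable_compose[OF YF total_mass_measurable] by measurable
  have r_int: "integrable P r"
    using r(2) r_le by (intro P.integrable_const_bound[where B = 1]) auto
  have "AE \<omega> in P. real_cond_exp P \<F> (indicator A) \<omega> \<le> r \<omega>"
  proof (rule F.real_cond_exp_leI[OF _ r(1) r_int])
    show "integrable P (indicator A :: _ \<Rightarrow> real)"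
      by (intro P.integrable_const_bound[where B = 1]) auto
    fix S assume "S \<in> sets \<F>"
    then obtain S' where S': "S' \<in> sets (config_algebra L)" "S = Y -` S' \<inter> space P"
      unfolding \<F>_def sets_vimage_algebra2[OF Y_space] by auto
    note [measurable] = S'(1) r(2) \<open>A \<in> sets P\<close> measurable_restr_measure[OF C]
    have [measurable]: "S \<in> sets P" unfolding S'(2) by measurable
    \<comment> \<open>The factor exp (- q) keeps H at most 1 and turns H (exp q - 1) into 1 - r on
      \<open>S\<close>.\<close>
    define H where "H \<mu> = indicator S' (restr_measure \<mu> C) * exp (- total_mass \<mu>)" for \<mu>
    have H: "H (\<xi> \<omega>) = indicator S \<omega> * r \<omega>" if "\<omega> \<in> space P" for \<omega>
      using that by (simp add: H_def S' r_def mass Y_def[symmetric] indicator_def)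
    have core: "(\<integral>\<^sup>+\<omega>. ennreal (H (\<xi> \<omega>) * (exp (total_mass (\<xi> \<omega>)) - 1)
        * (if emeasure (\<xi> \<omega>) B = 0 then 1 else 0)) \<partial>P)
      \<le> (\<integral>\<^sup>+\<omega>. ennreal (H (\<xi> \<omega>) * (if emeasure (\<xi> \<omega>) B = 0 then 0 else 1)) \<partial>P)"
    proof (rule nn_integral_void_le)
      show "H \<in> borel_measurable (config_algebra L)" unfolding H_def by measurable
      fix \<mu> assume \<mu>: "\<mu> \<in> configs L"
      show "0 \<le> H \<mu>" "H \<mu> \<le> 1"
        using total_mass_nonneg[of \<mu>] by (auto simp: H_def indicator_def)
      fix y assume y: "y \<in> B"
      then have "restr_measure (add_point \<mu> y) C = restr_measure \<mu> C"
        using C by (intro restr_measure_add_point) (auto simp: configs_sets[OF \<mu>] C_def)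
      then show "H (add_point \<mu> y) = H \<mu>"
        using \<mu> y by (simp add: H_def total_mass_add_point)
    qed
    \<comment> \<open>Split 1 = (1 - r) + r on the void event \<open>A\<close>. The first part is
      bounded by the integral of r over \<open>S\<close> outside \<open>A\<close>, the second is the
      integral of r over \<open>S\<close> inside \<open>A\<close>, and together they give the
      integral of r over \<open>S\<close>.\<close>
    have "(\<integral>\<^sup>+\<omega>. ennreal (indicator S \<omega> * indicator A \<omega>) \<partial>P) =
      (\<integral>\<^sup>+\<omega>. ennreal (indicator S \<omega> * (1 - r \<omega>) * indicator A \<omega>) + ennreal (indicator S \<omega> * r \<omega> * indicator A \<omega>) \<partial>P)"
      using r_le by (intro nn_integral_cong) (auto simp: indicator_def ennreal_plus[symmetric] simp del: ennreal_plus)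
    also have "\<dots> = (\<integral>\<^sup>+\<omega>. ennreal (indicator S \<omega> * (1 - r \<omega>) * indicator A \<omega>) \<partial>P)
        + (\<integral>\<^sup>+\<omega>. ennreal (indicator S \<omega> * r \<omega> * indicator A \<omega>) \<partial>P)"
      by (intro nn_integral_add) measurable
    also have "(\<integral>\<^sup>+\<omega>. ennreal (indicator S \<omega> * (1 - r \<omega>) * indicator A \<omega>) \<partial>P) =
      (\<integral>\<^sup>+\<omega>. ennreal (H (\<xi> \<omega>) * (exp (total_mass (\<xi> \<omega>)) - 1)
        * (if emeasure (\<xi> \<omega>) B = 0 then 1 else 0)) \<partial>P)"
      by (intro nn_integral_cong)
        (auto simp: H A_def indicator_def r_def mass algebra_simps exp_minus)
    also have "\<dots> \<le> (\<integral>\<^sup>+\<omega>. ennreal (H (\<xi> \<omega>) * (if emeasure (\<xi> \<omega>) B = 0 then 0 else 1)) \<partial>P)"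
      by (rule core)
    also have "\<dots> = (\<integral>\<^sup>+\<omega>. ennreal (indicator S \<omega> * r \<omega> * indicator (space P - A) \<omega>) \<partial>P)"
      by (intro nn_integral_cong) (auto simp: H A_def)
    also have "\<dots> + (\<integral>\<^sup>+\<omega>. ennreal (indicator S \<omega> * r \<omega> * indicator A \<omega>) \<partial>P) =
      (\<integral>\<^sup>+\<omega>. ennreal (indicator S \<omega> * r \<omega> * indicator (space P - A) \<omega>) + ennreal (indicator S \<omega> * r \<omega> * indicator A \<omega>) \<partial>P)"
      by (intro nn_integral_add[symmetric]) measurable
    also have "\<dots> = (\<integral>\<^sup>+\<omega>. ennreal (indicator S \<omega> * r \<omega>) \<partial>P)"
      by (intro nn_integral_cong) (auto simp: indicator_def)
    finally have le: "(\<integral>\<^sup>+\<omega>. ennreal (indicator S \<omega> * indicator A \<omega>) \<partial>P) \<le>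
        (\<integral>\<^sup>+\<omega>. ennreal (indicator S \<omega> * r \<omega>) \<partial>P)"
      by (simp add: add_right_mono)
    have int: "integrable P (\<lambda>\<omega>. indicator S \<omega> * r \<omega>)"
      using integrable_mult_indicator[OF \<open>S \<in> sets P\<close> r_int] by simp
    then have "(\<integral>\<^sup>+\<omega>. ennreal (indicator S \<omega> * r \<omega>) \<partial>P) < \<infinity>"
      using r_le by (subst nn_integral_eq_integral) auto
    with le have "enn2real (\<integral>\<^sup>+\<omega>. ennreal (indicator S \<omega> * indicator A \<omega>) \<partial>P) \<le>
        enn2real (\<integral>\<^sup>+\<omega>. ennreal (indicator S \<omega> * r \<omega>) \<partial>P)"
      by (intro enn2real_mono) auto
    also have "enn2real (\<integral>\<^sup>+\<omega>. ennreal (indicator S \<omega> * r \<omega>) \<partial>P) = (\<integral>\<omega>. indicator S \<omega> * r \<omega> \<partial>P)"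
      using r(2) r_le by (intro integral_eq_nn_integral[symmetric]) auto
    also have "enn2real (\<integral>\<^sup>+\<omega>. ennreal (indicator S \<omega> * indicator A \<omega>) \<partial>P) = (\<integral>\<omega>. indicator S \<omega> * indicator A \<omega> \<partial>P)"
      by (intro integral_eq_nn_integral[symmetric]) auto
    finally show "(\<integral>\<omega>\<in>S. indicator A \<omega> \<partial>P) \<le> (\<integral>\<omega>\<in>S. r \<omega> \<partial>P)"
      by (simp add: set_lebesgue_integral_def)
  qed
  then show ?thesis
    unfolding cond_prob_given_def Y_def[symmetric] A_def[symmetric] \<F>_def[symmetric] C_def[symmetric]
  proof (rule AE_mp, intro AE_I2 impI)
    fix \<omega> assume "\<omega> \<in> space P" "real_cond_exp P \<F> (indicator A) \<omega> \<le> r \<omega>"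
    then show "real_cond_exp P \<F> (indicator A) \<omega> \<le> exp (- total_mass (\<xi> \<omega>))"
      by (simp add: r_def mass)
  qed
qed

lemma free_part_eq:
  assumes \<mu>: "\<mu> \<in> configs L"
  shows "free_part R \<mu> B = {x \<in> B. isolated \<mu> x}"
proof -
  have "\<not> adj_config R x (restr_measure \<mu> (space L - B)) \<longleftrightarrow> isolated \<mu> x" if "x \<in> B" for x
    unfolding isolated_def
  proof (rule not_adj_config_iff[OF L.sigma_finite_measure_axioms phi singleton_sets \<mu>])
    show "{z \<in> space L. R x z} \<in> sets L" using B_space[OF that] by measurable
  qed simp_all
  then show ?thesis by (auto simp: free_part_def configs_space[OF \<mu>])
qed

text \<open>Both sides are the real value of the same nonnegative integral. It is finite by
  \<open>emeasure_intens_measure_le\<close>, so the default value of a divergent integral does not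
  arise.\<close>

lemma integral_free_part:
  assumes \<mu>: "\<mu> \<in> configs L"
  shows "(\<integral>x. indicator (free_part R \<mu> B) x * exp (- measure dom (nbhd L R x \<inter> B))
      * \<kappa> x (null_measure L) \<partial>L) = total_mass \<mu>"
proof -
  have "indicator (free_part R \<mu> B) x * exp (- measure dom (nbhd L R x \<inter> B)) * \<kappa> x (null_measure L)
      = intens \<mu> x" for x
    by (auto simp: free_part_eq[OF \<mu>] intens_def nb_mass_def indicator_def)
  then have "(\<integral>x. indicator (free_part R \<mu> B) x * exp (- measure dom (nbhd L R x \<inter> B))
      * \<kappa> x (null_measure L) \<partial>L) = (\<integral>x. intens \<mu> x \<partial>L)"
    by simp
  also have "\<dots> = enn2real (\<integral>\<^sup>+x. ennreal (intens \<mu> x) \<partial>L)"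
    using intens_measurable_fst[OF \<mu>] intens_nonneg by (intro integral_eq_nn_integral) auto
  also have "(\<integral>\<^sup>+x. ennreal (intens \<mu> x) \<partial>L) = emeasure (intens_measure \<mu>) (space L)"
    using \<mu> by (auto simp: emeasure_intens_measure intro!: nn_integral_cong)
  finally show ?thesis by (simp add: total_mass_def measure_def)
qed

end

theorem theorem7p1:
  fixes L :: "'a measure" and P :: "'w measure"
    and \<kappa> :: "'a \<Rightarrow> 'a measure \<Rightarrow> real" and \<alpha> :: "'a \<Rightarrow> real"
    and R :: "'a \<Rightarrow> 'a \<Rightarrow> bool" and \<xi> :: "'w \<Rightarrow> 'a measure" and B :: "'a set"
  assumes borel_space: "is_borel_space L"
    and sigma_finite: "sigma_finite_measure L"
    and diffuse: "diffuse_measure L"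
    and kappa_measurable: "(\<lambda>(x, \<mu>). \<kappa> x \<mu>) \<in> borel_measurable (L \<Otimes>\<^sub>M config_algebra L)"
    and kappa_nonneg: "\<forall>x\<in>space L. \<forall>\<mu>\<in>configs L. 0 \<le> \<kappa> x \<mu>"
    and cocycle: "\<forall>x\<in>space L. \<forall>y\<in>space L. \<forall>\<mu>\<in>configs L.
      \<kappa> x \<mu> * \<kappa> y (add_point \<mu> x) = \<kappa> y \<mu> * \<kappa> x (add_point \<mu> y)"
    and R_sym: "\<forall>x\<in>space L. \<forall>y\<in>space L. R x y \<longrightarrow> R y x"
    and R_measurable: "{(x, y) \<in> space L \<times> space L. R x y} \<in> sets (L \<Otimes>\<^sub>M L)"
    and alpha_measurable: "\<alpha> \<in> borel_measurable L"
    and alpha_pos: "\<forall>x\<in>space L. 0 < \<alpha> x"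
    and kappa_le_alpha: "\<forall>x\<in>space L. \<forall>\<mu>\<in>configs L. \<kappa> x \<mu> \<le> \<alpha> x"
    and alpha_locally_finite: "\<forall>A\<in>sets L. emeasure L A < \<infinity> \<longrightarrow> (\<integral>\<^sup>+x\<in>A. ennreal (\<alpha> x) \<partial>L) < \<infinity>"
    and kappa_cluster: "\<forall>x\<in>space L. \<forall>\<mu>\<in>configs L. \<kappa> x \<mu> = \<kappa> x (cluster R x \<mu>)"
    and gibbs: "gibbs_process P L \<kappa> \<xi>"
    and B: "B \<in> sets L" "emeasure L B < \<infinity>"
  shows "AE \<omega> in P.
    cond_prob_given P (config_algebra L) (\<lambda>\<omega>. restr_measure (\<xi> \<omega>) (space L - B))
      {\<omega> \<in> space P. emeasure (\<xi> \<omega>) B = 0} \<omega>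
    \<le> exp (- (\<integral>x. indicator (free_part R (\<xi> \<omega>) B) x
              * exp (- measure (density L (\<lambda>y. ennreal (\<alpha> y))) (nbhd L R x \<inter> B))
              * \<kappa> x (null_measure L) \<partial>L))"
proof -
  \<comment> \<open>The Borel space property is used through its embedding into [0, 1], which
    supplies the order for the last point; the left inverse \<open>g\<close> gives
    injectivity.\<close>
  obtain U \<phi> and g :: "real \<Rightarrow> 'a" where U: "U \<subseteq> {0..1}"
    and \<phi>: "\<phi> \<in> L \<rightarrow>\<^sub>M restrict_space borel U" "\<forall>x\<in>space L. g (\<phi> x) = x"
    using borel_space unfolding is_borel_space_def by auto
  have \<phi>_borel: "\<phi> \<in> borel_measurable L" and \<phi>_U: "\<phi> \<in> space L \<rightarrow> U"
    using \<phi>(1) by (auto simp: measurable_restrict_space2_iff)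
  interpret P: prob_space P
    using gibbs by (simp add: gibbs_process_def point_process_def)
  interpret L: sigma_finite_measure L by fact
  interpret cluster_gibbs_region P L \<kappa> \<alpha> \<xi> R B \<phi>
  proof unfold_locales
    show "inj_on \<phi> (space L)" using \<phi>(2) by (metis inj_on_inverseI)
    show "\<phi> ` space L \<subseteq> {0..1}" using \<phi>_U U by auto
  qed (use assms \<phi>_borel in \<open>auto simp: diffuse_measure_def\<close>)
  show ?thesis
    using cond_void_prob_le
  proof (rule AE_mp, intro AE_I2 impI)
    fix \<omega> assume \<omega>: "\<omega> \<in> space P"
    assume "cond_prob_given P (config_algebra L) (\<lambda>\<omega>. restr_measure (\<xi> \<omega>) (space L - B))
      {\<omega> \<in> space P. emeasure (\<xi> \<omega>) B = 0} \<omega> \<le> exp (- total_mass (\<xi> \<omega>))"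
    then show "cond_prob_given P (config_algebra L) (\<lambda>\<omega>. restr_measure (\<xi> \<omega>) (space L - B))
      {\<omega> \<in> space P. emeasure (\<xi> \<omega>) B = 0} \<omega>
    \<le> exp (- (\<integral>x. indicator (free_part R (\<xi> \<omega>) B) x
              * exp (- measure (density L (\<lambda>y. ennreal (\<alpha> y))) (nbhd L R x \<inter> B))
              * \<kappa> x (null_measure L) \<partial>L))"
      using integral_free_part[OF xi_configs[OF \<omega>]] by (simp add: dom_def)
  qed
qed

end
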